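(* Let $A,B,C_1,\dots,C_p,D_1,\dots,D_q$ be matrices in $\mathbb{C}^{r\times r}$ and $\mu\in\mathbb{C}$ such that $D_iD_j=D_jD_i$ for all $1\le i,j\le q$ and $\Re(\mu)>0$. Then, for each $1\le j\le q$ and $z>0$, the fractional integral of order $\mu$ satisfies $$\mathbf{I}^\mu\left[{}_pR_q(A,B;z)\,z^{D_j-I}\right]={}_pR_q\left(\begin{array}{c}C_1,\dots,C_p\\ D_1,\dots,D_{j-1},D_j+\mu I,D_{j+1},\dots,D_q\end{array}\mid A,B;z\right)z^{D_j+(\mu-1)I}\,\Gamma(D_j)\,\Gamma^{-1}(D_j+\mu I).$$
   Context: For $x>0$ and $\Re(\mu)>0$, the Riemann–Liouville fractional integral of order $\mu$ (based at $0$) is $(\mathbf{I}^\mu f)(x)=\frac{1}{\Gamma(\mu)}\int_0^x(x-t)^{\mu-1}f(t)\,dt$. For $x>0$, $x^M=\exp(M\ln x)$. $\Gamma(M)$ is the gamma matrix function (equal to $\int_0^\infty e^{-t}t^{M-I}\,dt$ for matrices $M$ all of whose eigenvalues have positive real part) and $\Gamma^{-1}(M)$ denotes the entire function $1/\Gamma$ applied to $M$. The Pochhammer symbol of $M\in\mathbb{C}^{r\times r}$ is $(M)_0=I$, $(M)_n=M(M+I)\cdots(M+(n-1)I)$ for $n\ge 1$. For matrices $A,B,C_1,\dots,C_p,D_1,\dots,D_q\in\mathbb{C}^{r\times r}$ such that each $D_j+kI$ is invertible for all integers $k\ge 0$, one defines $${}_pR_q(A,B;z)={}_pR_q\left(\begin{array}{c}C_1,\dots,C_p\\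 D_1,\dots,D_q\end{array}\mid A,B;z\right)=\sum_{n\ge 0}\Gamma^{-1}(nA+B)\,(C_1)_n\cdots(C_p)_n\,(D_1)_n^{-1}\cdots(D_q)_n^{-1}\,\frac{z^n}{n!},$$ with products taken in the written order. The invertibility condition in this definition is assumed for the parameters of every function ${}_pR_q$ appearing.
   Formalization: The series for the left-hand pRq is assumed to converge on (0,z], and the formula is asserted whenever the fractional integral exists as a Lebesgue integral; existence is proved when all eigenvalues of D_j have positive real part, and convergence of the right-hand series is proved. *)

theory Defs
  imports "HOL-Analysis.Analysis" "HOL-Complex_Analysis.Complex_Analysis"
begin

text \<open>
  Complex square matrices have type \<open>complex^'r^'r\<close>. The scalar multiple \<open>c M\<close> is written
  \<open>mat c ** M\<close>, since \<open>*s\<close> and \<open>*\<close> on this type are not scalar multiplication by a complex number.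
\<close>

definition eigenvalue_of :: "complex^'r^'r \<Rightarrow> complex \<Rightarrow> bool" where
  "eigenvalue_of M l \<longleftrightarrow> (\<exists>v. v \<noteq> 0 \<and> M *v v = l *s v)"

text \<open>
  Riesz--Dunford functional calculus: \<open>f(M)\<close> is \<open>1/(2\<pi>i)\<close> times the integral of
  \<open>f(z) (zI - M)\<^sup>-\<^sup>1\<close> over small positively oriented circles around the eigenvalues of \<open>M\<close>,
  written entrywise with residues. It is meaningful for \<open>f\<close> analytic at every eigenvalue of \<open>M\<close>.
\<close>
definition mat_fun :: "(complex \<Rightarrow> complex) \<Rightarrow> complex^'r^'r \<Rightarrow> complex^'r^'r" where
  "mat_fun f M = (\<chi> i j. \<Sum>l | eigenvalue_of M l.
      residue (\<lambda>z. f z * matrix_inv (mat z - M) $ i $ j) l)"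

text \<open>
  \<open>mat_Gamma M\<close> is meaningful when no eigenvalue of \<open>M\<close> is a pole of \<open>\<Gamma>\<close>, i.e. when all
  \<open>M + kI\<close> are invertible; \<open>mat_rGamma M\<close> is meaningful for every \<open>M\<close>.
\<close>
definition mat_Gamma :: "complex^'r^'r \<Rightarrow> complex^'r^'r" where
  "mat_Gamma M = mat_fun Gamma M"

definition mat_rGamma :: "complex^'r^'r \<Rightarrow> complex^'r^'r" where
  "mat_rGamma M = mat_fun rGamma M"

definition mat_exp :: "complex^'r^'r \<Rightarrow> complex^'r^'r" where
  "mat_exp M = (\<Sum>n. (1 / fact n) *\<^sub>R (((**) M) ^^ n) (mat 1))"

definition mat_powr :: "real \<Rightarrow> complex^'r^'r \<Rightarrow> complex^'r^'r" where
  "mat_powr x M = mat_exp (ln x *\<^sub>R M)"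

primrec mat_pochhammer :: "complex^'r^'r \<Rightarrow> nat \<Rightarrow> complex^'r^'r" where
  "mat_pochhammer M 0 = mat 1"
| "mat_pochhammer M (Suc n) = mat_pochhammer M n ** (M + mat (of_nat n))"

definition mat_prod_list :: "(complex^'r^'r) list \<Rightarrow> complex^'r^'r" where
  "mat_prod_list Ms = foldr (**) Ms (mat 1)"

text \<open>
  The parameters \<open>C\<^sub>1,\<dots>,C\<^sub>p\<close> and \<open>D\<^sub>1,\<dots>,D\<^sub>q\<close> are lists of lengths \<open>p\<close> and \<open>q\<close>, so that
  \<open>D\<^sub>j\<close> is \<open>Ds ! (j - 1)\<close>.
\<close>
definition pRq_admissible :: "(complex^'r^'r) list \<Rightarrow> bool" where
  "pRq_admissible Ds \<longleftrightarrow> (\<forall>D \<in> set Ds. \<forall>k::nat. invertible (D + mat (of_nat k)))"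

definition pRq_term ::
  "(complex^'r^'r) list \<Rightarrow> (complex^'r^'r) list \<Rightarrow> complex^'r^'r \<Rightarrow> complex^'r^'r
     \<Rightarrow> complex \<Rightarrow> nat \<Rightarrow> complex^'r^'r" where
  "pRq_term Cs Ds A B z n =
     mat_rGamma (real n *\<^sub>R A + B)
     ** mat_prod_list (map (\<lambda>C. mat_pochhammer C n) Cs)
     ** mat_prod_list (map (\<lambda>D. matrix_inv (mat_pochhammer D n)) Ds)
     ** mat (z ^ n / fact n)"

definition pRq ::
  "(complex^'r^'r) list \<Rightarrow> (complex^'r^'r) list \<Rightarrow> complex^'r^'r \<Rightarrow> complex^'r^'r
     \<Rightarrow> complex \<Rightarrow> complex^'r^'r" where
  "pRq Cs Ds A B z = (\<Sum>n. pRq_term Cs Ds A B z n)"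

text \<open>
  The Riemann--Liouville integral is a Lebesgue integral; \<open>RL_integrable \<mu> f x\<close> says that it exists.
\<close>
definition RL_integrable :: "complex \<Rightarrow> (real \<Rightarrow> complex^'r^'r) \<Rightarrow> real \<Rightarrow> bool" where
  "RL_integrable \<mu> f x \<longleftrightarrow>
     set_integrable lborel {0<..<x} (\<lambda>t. mat (complex_of_real (x - t) powr (\<mu> - 1)) ** f t)"

definition RL_integral :: "complex \<Rightarrow> (real \<Rightarrow> complex^'r^'r) \<Rightarrow> real \<Rightarrow> complex^'r^'r" where
  "RL_integral \<mu> f x = mat (1 / Gamma \<mu>) **
     (LINT t:{0<..<x}|lborel. mat (complex_of_real (x - t) powr (\<mu> - 1)) ** f t)"

end

theory Submission
  imports Defs "HOL-Computational_Algebra.Fundamental_Theorem_Algebra"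
begin

text \<open>
  Every vector is a sum of generalized eigenvectors of \<open>D = D\<^sub>j\<close>, so it suffices to
  compare both sides on a vector \<open>v\<close> with \<open>(D - l)\<^sup>K v = 0\<close>. There the residue definition
  gives \<open>f(D) v = \<Sum>k<K. f\<^sup>(\<^sup>k\<^sup>)(l)/k! (D - l)\<^sup>k v\<close>, and the fractional integral of
  \<open>t\<^sup>n t\<^sup>D\<^sup>-\<^sup>I v\<close> becomes the statement that the moments of the beta kernel against powers of
  \<open>ln t\<close> are the Taylor coefficients of \<open>w \<mapsto> z\<^sup>w\<^sup>+\<^sup>n\<^sup>+\<^sup>\<mu>\<^sup>-\<^sup>1 \<Gamma>(w + n) \<Gamma>(\<mu>) / \<Gamma>(w + n + \<mu>)\<close> at \<open>l\<close>.
  The series converges at \<open>z\<close> only conditionally, but by Abel summation its partial sums are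
  uniformly bounded on \<open>(0, z]\<close>, so dominated convergence allows integration term by term
  as soon as \<open>Re l + n > 0\<close>. For the finitely many \<open>n\<close> with \<open>Re l + n \<le> 0\<close>, integrability near \<open>0\<close>
  forces the \<open>n\<close>th coefficient to vanish on the generalized eigenspace of \<open>l\<close>.
\<close>

text \<open>The obstacle is the spectrum of \<open>D\<close>. Admissibility only keeps nonpositive
  integers out of it, so eigenvalues with negative real part are allowed. The beta integral then
  covers a term only from an index on that depends on the generalized eigenspace, and the
  matrix-valued terms cannot be integrated one by one; each generalized eigenvector gets its own
  threshold. The matrices \<open>A\<close>, \<open>B\<close> and \<open>Cs\<close> need not commute
  with \<open>D\<close>. Every function of \<open>D\<close> therefore stays to the right of the
  coefficients and acts on the vector first. Commutation within \<open>Ds\<close> enters when a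
  Pochhammer symbol of \<open>D\<close> has to pass the factors behind it in the product. The factor
  \<open>W\<close> on the right of the claimed identity is common to all terms of the shifted
  series. Term by term, the shifted series times \<open>W\<close> equals coefficient times moment,
  an identity between scalar functions evaluated at \<open>D\<close>. Admissibility of the shifted
  list makes \<open>W\<close> invertible, so convergence of the shifted series follows from
  convergence of the moment series. Generalized eigenvectors found through an annihilating
  polynomial serve in place of a Jordan form.\<close>

lemma mat_mult_vec: "mat c *v (v::'a::semiring_1^'n) = c *s v"
  by (simp add: mat_def matrix_vector_mult_def vec_eq_iff if_distrib[where f = "\<lambda>x. x * y" for y] cong: if_cong)

lemma mat_mult_mat: "(mat a :: 'a::semiring_1^'n^'n) ** mat b = mat (a * b)"
  by (simp add: matrix_eq mat_mult_vec mult.assoc vec_eq_iff flip: matrix_vector_mul_assoc)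

lemma mat_add_mat: "(mat a :: 'a::semiring_1^'n^'n) + mat b = mat (a + b)"
  by (simp add: mat_def vec_eq_iff)

lemma mat_diff_mat: "(mat a :: 'a::ring_1^'n^'n) - mat b = mat (a - b)"
  by (simp add: mat_def vec_eq_iff)

lemma mat_mult_commute: "(M :: 'a::field^'n^'n) ** mat c = mat c ** M"
  by (simp add: matrix_eq mat_mult_vec vector_scalar_commute flip: matrix_vector_mul_assoc)

lemma matrix_vector_mult_sum_right: "M *v (\<Sum>i\<in>A. f i) = (\<Sum>i\<in>A. M *v f i)"
  for M :: "'a::ring_1^'n^'m"
  by (induction A rule: infinite_finite_induct) (simp_all add: matrix_vector_right_distrib)

lemma matrix_vector_mult_sum_left: "(\<Sum>i\<in>A. f i) *v v = (\<Sum>i\<in>A. f i *v v)"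
  for v :: "'a::ring_1^'n"
  by (induction A rule: infinite_finite_induct) (simp_all add: matrix_vector_mult_add_rdistrib)

lemma scaleR_matrix_vector: "(a *\<^sub>R M) *v v = a *\<^sub>R (M *v (v::'a::real_algebra_1^'n))"
  by (simp add: matrix_vector_mult_def vec_eq_iff scaleR_sum_right)

lemma matrix_inv_right: "invertible (M::'a::semiring_1^'n^'n) \<Longrightarrow> M ** matrix_inv M = mat 1"
  and matrix_inv_left: "invertible (M::'a::semiring_1^'n^'n) \<Longrightarrow> matrix_inv M ** M = mat 1"
  unfolding invertible_def matrix_inv_def by (metis (mono_tags, lifting) someI_ex)+

section \<open>Generalized eigenvectors\<close>

definition shift_pow :: "complex^'n^'n \<Rightarrow> complex \<Rightarrow> nat \<Rightarrow> complex^'n \<Rightarrow> complex^'n" where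
  "shift_pow M l k v = ((*v) (M - mat l) ^^ k) v"

text \<open>The exponent may depend on the vector, and \<open>l\<close> may be any number: off the
  spectrum the set is {0}, so no spectral side condition has to be carried along.\<close>

definition gen_eigenspace :: "complex^'n^'n \<Rightarrow> complex \<Rightarrow> (complex^'n) set" where
  "gen_eigenspace M l = {v. \<exists>K. shift_pow M l K v = 0}"

lemma shift_pow_0 [simp]: "shift_pow M l 0 v = v"
  by (simp add: shift_pow_def)

lemma shift_pow_Suc: "shift_pow M l (Suc k) v = (M - mat l) *v shift_pow M l k v"
  by (simp add: shift_pow_def)

lemma shift_pow_Suc2: "shift_pow M l (Suc k) v = shift_pow M l k ((M - mat l) *v v)"
  by (simp add: shift_pow_def funpow_swap1)

lemma shift_pow_add: "shift_pow M l (j + k) v = shift_pow M l j (shift_pow M l k v)"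
  by (simp add: shift_pow_def funpow_add)

lemma shift_pow_zero [simp]: "shift_pow M l k 0 = 0"
  by (induction k) (simp_all add: shift_pow_Suc)

lemma shift_pow_eq_0_mono: "shift_pow M l K v = 0 \<Longrightarrow> K \<le> k \<Longrightarrow> shift_pow M l k v = 0"
  using shift_pow_add[of M l "k - K" K v] by simp

lemma shift_pow_plus: "shift_pow M l k (v + w) = shift_pow M l k v + shift_pow M l k w"
  by (induction k) (simp_all add: shift_pow_Suc matrix_vector_right_distrib)

lemma shift_pow_scale: "shift_pow M l k (c *s v) = c *s shift_pow M l k v"
  by (induction k) (simp_all add: shift_pow_Suc vector_scalar_commute)

lemma shift_pow_diff: "shift_pow M l k (v - w) = shift_pow M l k v - shift_pow M l k w"
  by (induction k) (simp_all add: shift_pow_Suc matrix_vector_mult_diff_distrib)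

lemma shift_pow_sum: "shift_pow M l k (\<Sum>i\<in>A. f i) = (\<Sum>i\<in>A. shift_pow M l k (f i))"
  by (induction A rule: infinite_finite_induct) (simp_all add: shift_pow_plus)

lemma matrix_vector_shift_pow:
  "M *v shift_pow M l k v = l *s shift_pow M l k v + shift_pow M l (Suc k) v"
  by (simp add: shift_pow_Suc matrix_vector_mult_diff_rdistrib mat_mult_vec)

lemma zero_in_gen_eigenspace [simp]: "0 \<in> gen_eigenspace M l"
  by (simp add: gen_eigenspace_def)

lemma gen_eigenspace_add:
  assumes "v \<in> gen_eigenspace M l" "w \<in> gen_eigenspace M l"
  shows "v + w \<in> gen_eigenspace M l"
proof -
  obtain K L where "shift_pow M l K v = 0" "shift_pow M l L w = 0"
    using assms by (auto simp: gen_eigenspace_def)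
  then have "shift_pow M l (max K L) (v + w) = 0"
    by (simp add: shift_pow_plus shift_pow_eq_0_mono[of M l K v] shift_pow_eq_0_mono[of M l L w])
  then show ?thesis by (auto simp: gen_eigenspace_def)
qed

lemma gen_eigenspace_scale: "v \<in> gen_eigenspace M l \<Longrightarrow> c *s v \<in> gen_eigenspace M l"
  by (auto simp: gen_eigenspace_def shift_pow_scale)

lemma gen_eigenspace_shift_pow: "shift_pow M l k v \<in> gen_eigenspace M l \<longleftrightarrow> v \<in> gen_eigenspace M l"
proof
  assume "shift_pow M l k v \<in> gen_eigenspace M l"
  then show "v \<in> gen_eigenspace M l"
    by (auto simp: gen_eigenspace_def simp flip: shift_pow_add)
next
  assume "v \<in> gen_eigenspace M l"
  then obtain K where "shift_pow M l K v = 0" by (auto simp: gen_eigenspace_def)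
  then have "shift_pow M l K (shift_pow M l k v) = 0"
    by (simp add: shift_pow_eq_0_mono flip: shift_pow_add)
  then show "shift_pow M l k v \<in> gen_eigenspace M l"
    by (auto simp: gen_eigenspace_def)
qed

text \<open>The last nonzero vector of the chain v, (M - l) v, (M - l)^2 v, ... is an
  eigenvector.\<close>

lemma gen_eigenspace_eigenvalue:
  assumes "v \<in> gen_eigenspace M l" "v \<noteq> 0"
  shows "eigenvalue_of M l"
proof -
  define K where "K = (LEAST K. shift_pow M l K v = 0)"
  have K: "shift_pow M l K v = 0"
    unfolding K_def using assms by (auto simp: gen_eigenspace_def intro: LeastI)
  then obtain k where k: "K = Suc k" using assms by (cases K) auto
  have "shift_pow M l k v \<noteq> 0"
    using not_less_Least[of k "\<lambda>K. shift_pow M l K v = 0"] k K_def by auto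
  moreover have "M *v shift_pow M l k v = l *s shift_pow M l k v"
    using K k by (simp add: matrix_vector_shift_pow)
  ultimately show ?thesis by (auto simp: eigenvalue_of_def)
qed

text \<open>On such vectors M - a = (l - a) + (M - l) is a nonzero scalar plus a nilpotent map,
  hence invertible. The induction on \<open>K\<close> solves first for (M - l) v, whose chain is
  shorter.\<close>

lemma gen_eigenspace_solve:
  assumes "l \<noteq> a" "shift_pow M l K v = 0"
  shows "\<exists>u. shift_pow M l K u = 0 \<and> (M - mat a) *v u = v"
  using assms(2)
proof (induction K arbitrary: v)
  case 0
  then show ?case by (intro exI[of _ 0]) simp
next
  case (Suc K)
  then obtain u where u: "shift_pow M l K u = 0" "(M - mat a) *v u = (M - mat l) *v v"
    by (metis shift_pow_Suc2)
  \<comment> \<open>Since (M - a) v = (M - l) v + (l - a) v and (M - a) u = (M - l) v, the vector v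
    - u is sent to (l - a) v.\<close>
  define w where "w = (1 / (l - a)) *s (v - u)"
  have *: "(M - mat a) *v v = (M - mat l) *v v + (l - a) *s v"
    by (simp add: matrix_vector_mult_diff_rdistrib mat_mult_vec vec_eq_iff algebra_simps)
  have "(M - mat a) *v w = v"
    unfolding w_def vector_scalar_commute matrix_vector_mult_diff_distrib * u(2)
    using assms(1) by (simp add: vec_eq_iff flip: diff_divide_distrib left_diff_distrib)
  moreover have "shift_pow M l (Suc K) w = 0"
    using Suc.prems shift_pow_eq_0_mono[OF u(1), of "Suc K"]
    by (simp only: w_def shift_pow_scale shift_pow_diff) simp
  ultimately show ?case by blast
qed

section \<open>Polynomials in a matrix, evaluated on vectors, and the spanning theorem\<close>

definition poly_vec :: "complex^'n^'n \<Rightarrow> complex poly \<Rightarrow> complex^'n \<Rightarrow> complex^'n" where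
  "poly_vec M p = fold_coeffs (\<lambda>a f v. a *s v + f (M *v v)) p (\<lambda>_. 0)"

lemma poly_vec_0 [simp]: "poly_vec M 0 v = 0"
  by (simp add: poly_vec_def)

lemma poly_vec_pCons [simp]: "poly_vec M (pCons a p) v = a *s v + poly_vec M p (M *v v)"
  by (cases "p = 0"; cases "a = 0") (simp_all add: poly_vec_def)

lemma poly_vec_add: "poly_vec M (p + q) v = poly_vec M p v + poly_vec M q v"
  by (induction p q arbitrary: v rule: poly_induct2) (simp_all add: vec.scale_left_distrib)

lemma poly_vec_smult: "poly_vec M (smult c p) v = poly_vec M p (c *s v)"
  by (induction p arbitrary: v) (simp_all add: vector_scalar_commute mult.commute)

lemma poly_vec_sum: "poly_vec M (\<Sum>i\<in>A. f i) v = (\<Sum>i\<in>A. poly_vec M (f i) v)"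
  by (induction A rule: infinite_finite_induct) (simp_all add: poly_vec_add)

lemma poly_vec_monom: "poly_vec M (monom c i) v = c *s ((((**) M ^^ i) (mat 1)) *v v)"
proof (induction i arbitrary: v)
  case 0 then show ?case by (simp add: monom_0)
next
  case (Suc i)
  have "((**) M ^^ i) (mat 1) *v (M *v v) = ((**) M ^^ Suc i) (mat 1) *v v"
  proof (induction i)
    case (Suc i) then show ?case by (simp flip: matrix_vector_mul_assoc)
  qed simp
  with Suc show ?case by (simp add: monom_Suc)
qed

lemma poly_vec_vadd: "poly_vec M p (v + w) = poly_vec M p v + poly_vec M p w"
  by (induction p arbitrary: v w) (simp_all add: vec.scale_right_distrib matrix_vector_right_distrib)

lemma poly_vec_root: "poly_vec M ([:-a, 1:] * q) v = poly_vec M q ((M - mat a) *v v)"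
proof -
  have "(M - mat a) *v v = M *v v + (-a) *s v"
    by (simp add: matrix_vector_mult_diff_rdistrib mat_mult_vec vec_eq_iff)
  moreover have "[:-a, 1:] * q = smult (-a) q + pCons 0 q" by simp
  ultimately show ?thesis
    by (simp only: poly_vec_add poly_vec_smult poly_vec_vadd poly_vec_pCons) (simp add: add.commute)
qed

lemma poly_vec_eigenvector: "M *v v = l *s v \<Longrightarrow> poly_vec M p (c *s v) = (c * poly p l) *s v"
proof (induction p arbitrary: c)
  case (pCons a p)
  have "poly_vec M (pCons a p) (c *s v) = (a * c) *s v + poly_vec M p ((c * l) *s v)"
    by (simp add: vector_scalar_commute pCons.prems)
  also have "\<dots> = (a * c) *s v + (c * l * poly p l) *s v"
    by (simp only: pCons.IH[OF pCons.prems])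
  also have "\<dots> = (c * poly (pCons a p) l) *s v"
    by (simp only: vec.scale_left_distrib[symmetric]) (simp add: distrib_left mult_ac)
  finally show ?case .
qed simp

lemma of_real_scale: "(of_real a :: complex) *s v = a *\<^sub>R (v :: complex^'n)"
proof -
  have "((of_real a :: complex) *s v) $ i = (a *\<^sub>R v) $ i" for i
    by (simp only: vector_smult_component vector_scaleR_component scaleR_conv_of_real[of a "v $ i"])
  then show ?thesis by (simp only: vec_eq_iff simp_thms)
qed

text \<open>There are d + 1 powers I, M, ..., M^d in a space of real dimension d. If they are
  distinct, a real linear dependence gives the coefficients. If two of them coincide, the set has
  fewer elements and its dependence says nothing, but the difference of the two monomials
  works.\<close>

lemma ex_annihilating_poly:
  fixes M :: "complex^'n^'n"
  shows "\<exists>p. p \<noteq> 0 \<and> (\<forall>v. poly_vec M p v = 0)"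
proof -
  define P where "P i = ((**) M ^^ i) (mat 1)" for i
  define d where "d = DIM(complex^'n^'n)"
  show ?thesis
  proof (cases "inj_on P {..d}")
    case True
    then have "card (P ` {..d}) = Suc d" by (simp add: card_image)
    then have "dependent (P ` {..d})"
      using independent_bound[of "P ` {..d}"] unfolding d_def by fastforce
    then obtain u where u: "\<exists>X\<in>P ` {..d}. u X \<noteq> 0" "(\<Sum>X\<in>P ` {..d}. u X *\<^sub>R X) = 0"
      by (subst (asm) dependent_finite) auto
    then have S: "(\<Sum>i\<le>d. u (P i) *\<^sub>R P i) = 0"
      by (simp add: sum.reindex[OF True])
    define p where "p = (\<Sum>i\<le>d. monom (of_real (u (P i)) :: complex) i)"
    have "coeff p i = of_real (u (P i))" if "i \<le> d" for i
      using that by (simp add: p_def coeff_sum)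
    with u(1) have "p \<noteq> 0" by force
    moreover have "poly_vec M p v = 0" for v
    proof -
      have "poly_vec M p v = (\<Sum>i\<le>d. u (P i) *\<^sub>R P i) *v v"
        by (simp add: p_def poly_vec_sum poly_vec_monom P_def matrix_vector_mult_sum_left
              scaleR_matrix_vector of_real_scale)
      then show ?thesis by (simp add: S)
    qed
    ultimately show ?thesis by blast
  next
    case False
    then obtain i j where ij: "i \<noteq> j" "P i = P j" by (auto simp: inj_on_def)
    have "monom 1 i + monom (-1) j \<noteq> (0 :: complex poly)"
      using ij(1) by (metis add.right_neutral coeff_0 coeff_add coeff_monom zero_neq_one)
    moreover have "poly_vec M (monom 1 i + monom (-1) j) v = 0" for v
      using ij(2) by (simp add: poly_vec_add poly_vec_monom P_def)
    ultimately show ?thesis by blast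
  qed
qed

lemma finite_eigenvalues: "finite {l. eigenvalue_of M l}"
proof -
  obtain p where p: "p \<noteq> 0" "\<And>v. poly_vec M p v = 0"
    using ex_annihilating_poly by blast
  have "poly p l = 0" if l: "eigenvalue_of M l" for l
  proof -
    obtain v where "v \<noteq> 0" "M *v v = l *s v" using l by (auto simp: eigenvalue_of_def)
    then show ?thesis using poly_vec_eigenvector[of M v l p 1] p(2)[of v] by simp
  qed
  then show ?thesis
    using finite_subset[OF _ poly_roots_finite[OF p(1)]] by blast
qed

text \<open>Induction on the degree of a polynomial that kills v. With a root a, the vector (M - a)
  v is killed by the quotient and so lies in the span G. Some u in G has the same image under M - a
  up to a generalized eigenvector for a, which makes u - v itself a generalized eigenvector for
  a.\<close>

lemma span_gen_eigenspaces: "vec.span (\<Union>l. gen_eigenspace M l) = UNIV"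
proof -
  define G where "G = vec.span (\<Union>l. gen_eigenspace M l)"
  have G_mem: "v \<in> G" if "v \<in> gen_eigenspace M l" for v l
    unfolding G_def using that by (auto intro: vec.span_base)
  \<comment> \<open>M - a can be inverted on generalized eigenvectors for l different from a. For l
    = a the solution 0 leaves an error inside the generalized eigenspace of a, which is all that the
    induction needs.\<close>
  have almost_solve: "\<exists>u\<in>G. (M - mat a) *v u - w \<in> gen_eigenspace M a" if "w \<in> G" for a w
    using that unfolding G_def
  proof (induction rule: vec.span_induct_alt)
    case base
    then show ?case by (intro bexI[of _ 0]) (auto intro: vec.span_zero)
  next
    case (step c x y)
    then obtain u l where u: "u \<in> G" "(M - mat a) *v u - y \<in> gen_eigenspace M a"
      and x: "x \<in> gen_eigenspace M l" by (auto simp: G_def)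
    have "\<exists>w\<in>G. (M - mat a) *v w - x \<in> gen_eigenspace M a"
    proof (cases "l = a")
      case True
      then show ?thesis using gen_eigenspace_scale[OF x, of "-1"]
        by (intro bexI[of _ 0]) (auto simp: G_def intro: vec.span_zero)
    next
      case False
      obtain K where "shift_pow M l K x = 0" using x by (auto simp: gen_eigenspace_def)
      from gen_eigenspace_solve[OF False this] obtain w
        where w: "shift_pow M l K w = 0" "(M - mat a) *v w = x" by blast
      then show ?thesis by (intro bexI[of _ w]) (auto intro!: G_mem[of _ l] simp: gen_eigenspace_def)
    qed
    then obtain w where w: "w \<in> G" "(M - mat a) *v w - x \<in> gen_eigenspace M a" by blast
    have "(M - mat a) *v (c *s w + u) - (c *s x + y) =
            c *s ((M - mat a) *v w - x) + ((M - mat a) *v u - y)"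
      by (simp add: matrix_vector_right_distrib vector_scalar_commute vec.scale_right_diff_distrib)
    then have "(M - mat a) *v (c *s w + u) - (c *s x + y) \<in> gen_eigenspace M a"
      using u w by (metis gen_eigenspace_add gen_eigenspace_scale)
    moreover have "c *s w + u \<in> G" using u w by (auto simp: G_def intro: vec.span_add vec.span_scale)
    ultimately show ?case by (auto simp: G_def)
  qed
  have main: "v \<in> G" if "p \<noteq> 0" "poly_vec M p v = 0" for p v
    using that
  proof (induction "degree p" arbitrary: p v)
    case 0
    then obtain c where "p = [:c:]" by (metis degree_eq_zeroE)
    with 0 show ?case by (auto simp: G_def intro: vec.span_zero)
  next
    case (Suc n)
    then obtain a where "poly p a = 0"
      using alg_closed_imp_poly_has_root[of p] by auto
    then obtain q where q: "p = [:-a, 1:] * q" by (metis dvdE poly_eq_0_iff_dvd)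
    with Suc.prems have q0: "q \<noteq> 0" by auto
    then have "degree q = n" using Suc.hyps(2) q by (simp add: degree_mult_eq del: mult_pCons_left)
    moreover have "poly_vec M q ((M - mat a) *v v) = 0"
      using Suc.prems by (simp only: q poly_vec_root)
    ultimately have "(M - mat a) *v v \<in> G" using Suc.hyps(1) q0 by blast
    from almost_solve[OF this] obtain u
      where u: "u \<in> G" "(M - mat a) *v u - (M - mat a) *v v \<in> gen_eigenspace M a" by blast
    have "shift_pow M a 1 (u - v) \<in> gen_eigenspace M a"
      using u(2) by (simp add: shift_pow_Suc2 matrix_vector_mult_diff_distrib)
    then have "u - v \<in> G" by (auto simp only: gen_eigenspace_shift_pow intro: G_mem)
    with u(1) have "u - (u - v) \<in> G" unfolding G_def by (rule vec.span_diff)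
    then show ?case by simp
  qed
  show ?thesis using main ex_annihilating_poly[of M] by (auto simp: G_def)
qed

lemma gen_eigenspaces_induct [consumes 0, case_names gen scale_add]:
  assumes gen: "\<And>l v. v \<in> gen_eigenspace M l \<Longrightarrow> P v"
    and add: "\<And>c v w. P v \<Longrightarrow> P w \<Longrightarrow> P (c *s v + w)"
  shows "P v"
proof -
  have "v \<in> vec.span (\<Union>l. gen_eigenspace M l)" by (simp add: span_gen_eigenspaces)
  then show ?thesis
  proof (induction rule: vec.span_induct_alt)
    \<comment> \<open>The zero vector belongs to every generalized eigenspace, so any
      \<open>l\<close> will do.\<close>
    case base show ?case by (rule gen[of _ undefined]) simp
  next
    case (step c x y) then show ?case by (auto intro: add gen)
  qed
qed

section \<open>Functional calculus\<close>

lemma eigenvalue_of_iff_not_invertible: "eigenvalue_of M l \<longleftrightarrow> \<not> invertible (mat l - M)"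
proof -
  have "invertible (mat l - M) \<longleftrightarrow> (\<forall>v. M *v v = l *s v \<longrightarrow> v = 0)"
    unfolding invertible_left_inverse matrix_left_invertible_ker
    by (simp add: matrix_vector_mult_diff_rdistrib mat_mult_vec eq_commute[of "_ *s _"])
  then show ?thesis by (auto simp: eigenvalue_of_def)
qed

lemma eigenvalue_of_add: "eigenvalue_of (M + mat c) l \<longleftrightarrow> eigenvalue_of M (l - c)"
proof -
  have *: "mat l - (M + mat c) = mat (l - c) - M" by (simp flip: mat_diff_mat)
  show ?thesis by (simp only: eigenvalue_of_iff_not_invertible *)
qed

lemma invertible_iff_not_eigenvalue: "invertible (M + mat c) \<longleftrightarrow> \<not> eigenvalue_of M (- c)"
proof -
  have "invertible (M + mat c) \<longleftrightarrow> (\<forall>v. M *v v = (- c) *s v \<longrightarrow> v = 0)"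
    unfolding invertible_left_inverse matrix_left_invertible_ker
    by (simp add: matrix_vector_mult_add_rdistrib mat_mult_vec add_eq_0_iff2)
  then show ?thesis by (auto simp: eigenvalue_of_def)
qed

text \<open>The Neumann series of the resolvent in powers of (M - l) / (z - l) breaks off after K
  terms; multiplying by z - M makes the sum telescope.\<close>

lemma resolvent_gen_eigenvector:
  assumes K: "shift_pow M l K v = 0" and z: "\<not> eigenvalue_of M z" "z \<noteq> l"
  shows "matrix_inv (mat z - M) *v v = (\<Sum>k<K. (1 / (z - l) ^ Suc k) *s shift_pow M l k v)"
    (is "_ = ?S")
proof -
  have *: "(mat z - M) *v ((1 / (z - l) ^ Suc k) *s shift_pow M l k v)
      = (1 / (z - l) ^ k) *s shift_pow M l k v - (1 / (z - l) ^ Suc k) *s shift_pow M l (Suc k) v" for k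
  proof -
    have "(mat z - M) *v shift_pow M l k v = (z - l) *s shift_pow M l k v - shift_pow M l (Suc k) v"
      by (simp add: matrix_vector_mult_diff_rdistrib mat_mult_vec matrix_vector_shift_pow
            vec.scale_left_diff_distrib)
    moreover have "1 / (z - l) ^ Suc k * (z - l) = 1 / (z - l) ^ k"
      using z(2) by simp
    ultimately show ?thesis
      by (simp only: vector_scalar_commute vec.scale_right_diff_distrib vec.scale_scale)
  qed
  have "(mat z - M) *v ?S = v - (1 / (z - l) ^ K) *s shift_pow M l K v"
    unfolding matrix_vector_mult_sum_right *
    by (subst sum_lessThan_telescope') simp
  then have "(mat z - M) *v ?S = v" using K by simp
  then have "matrix_inv (mat z - M) *v v = (matrix_inv (mat z - M) ** (mat z - M)) *v ?S"
    by (simp only: flip: matrix_vector_mul_assoc)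
  then show ?thesis
    using z(1) by (simp add: matrix_inv_left eigenvalue_of_iff_not_invertible)
qed

lemma matrix_axis_component: "(A *v axis j 1) $ i = (A $ i $ j :: 'a::semiring_1)"
  by (simp add: matrix_vector_mult_def axis_def if_distrib cong: if_cong)

text \<open>On a generalized eigenvector the resolvent is a polynomial in 1 / (z - l). A nonzero
  vector forces \<open>l\<close> into the spectrum, so the only pole is already excluded.\<close>

lemma resolvent_holomorphic:
  "(\<lambda>z. (matrix_inv (mat z - M) *v v) $ i) holomorphic_on - {l. eigenvalue_of M l}"
proof (induction v rule: gen_eigenspaces_induct[where M = M])
  case (gen l v)
  then obtain K where K: "shift_pow M l K v = 0" by (auto simp: gen_eigenspace_def)
  show ?case
  proof (cases "v = 0")
    case False
    with gen have l: "eigenvalue_of M l" by (rule gen_eigenspace_eigenvalue)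
    have hol: "(\<lambda>z. \<Sum>k<K. 1 / (z - l) ^ Suc k * shift_pow M l k v $ i) holomorphic_on - {l. eigenvalue_of M l}"
      using l by (intro holomorphic_intros) auto
    have eq: "(matrix_inv (mat z - M) *v v) $ i = (\<Sum>k<K. 1 / (z - l) ^ Suc k * shift_pow M l k v $ i)"
      if "\<not> eigenvalue_of M z" for z
    proof -
      have "z \<noteq> l" using l that by auto
      with resolvent_gen_eigenvector[OF K that] show ?thesis by simp
    qed
    show ?thesis
      by (rule holomorphic_transform[OF hol]) (rule eq[symmetric], simp)
  qed simp
next
  case (scale_add c v w)
  then show ?case
    by (simp add: matrix_vector_right_distrib vector_scalar_commute) (intro holomorphic_intros)
qed

lemma residue_sum:
  assumes "open s" "z \<in> s" "\<And>a. a \<in> A \<Longrightarrow> f a holomorphic_on s - {z}"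
  shows "residue (\<lambda>w. \<Sum>a\<in>A. f a w) z = (\<Sum>a\<in>A. residue (f a) z)"
  using assms(3)
proof (induction A rule: infinite_finite_induct)
  case (insert a A)
  then show ?case
    by (simp add: residue_add[OF assms(1,2)] holomorphic_on_sum)
qed (simp_all add: residue_const)

lemma analytic_at_eigenvalue_nbhd:
  assumes "f analytic_on {l. eigenvalue_of M l}" "eigenvalue_of M l"
  obtains s where "open s" "l \<in> s" "f holomorphic_on s" "s - {l} \<subseteq> - {l. eigenvalue_of M l}"
proof -
  obtain e where e: "e > 0" "f holomorphic_on ball l e"
    using assms by (auto simp: analytic_on_def)
  have "finite ({l. eigenvalue_of M l} - {l})"
    using finite_eigenvalues[of M] by simp
  then have "open (ball l e - ({l. eigenvalue_of M l} - {l}))"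
    by (intro open_Diff open_ball finite_imp_closed)
  moreover have "f holomorphic_on ball l e - ({l. eigenvalue_of M l} - {l})"
    using e by (auto intro: holomorphic_on_subset)
  ultimately show ?thesis
    using e(1) by (intro that[of "ball l e - ({l. eigenvalue_of M l} - {l})"]) auto
qed

text \<open>Passes from matrix entries to the action on a vector, where the resolvent formula
  applies. Additivity of residues needs holomorphy in a punctured neighbourhood, available because
  the spectrum is finite.\<close>

lemma mat_fun_vec_component:
  assumes "f analytic_on {l. eigenvalue_of M l}"
  shows "(mat_fun f M *v v) $ i =
    (\<Sum>l | eigenvalue_of M l. residue (\<lambda>z. f z * (matrix_inv (mat z - M) *v v) $ i) l)"
proof -
  have "(\<Sum>j\<in>UNIV. residue (\<lambda>z. f z * matrix_inv (mat z - M) $ i $ j) l * v $ j) =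
        residue (\<lambda>z. f z * (matrix_inv (mat z - M) *v v) $ i) l"
    if l: "eigenvalue_of M l" for l
  proof -
    obtain s where s: "open s" "l \<in> s" "f holomorphic_on s" "s - {l} \<subseteq> - {l. eigenvalue_of M l}"
      using analytic_at_eigenvalue_nbhd[OF assms l] by blast
    have hol: "(\<lambda>z. f z * matrix_inv (mat z - M) $ i $ j) holomorphic_on s - {l}" for j
    proof -
      have "matrix_inv (mat z - M) $ i $ j = (matrix_inv (mat z - M) *v axis j 1) $ i" for z
        by (simp add: matrix_axis_component)
      moreover have "f holomorphic_on s - {l}" using s(3) by (rule holomorphic_on_subset) auto
      ultimately show ?thesis
        using holomorphic_on_subset[OF resolvent_holomorphic[of M "axis j 1" i] s(4)]
        by (auto intro: holomorphic_on_mult)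
    qed
    have "(\<lambda>z. f z * (matrix_inv (mat z - M) *v v) $ i) =
          (\<lambda>z. \<Sum>j\<in>UNIV. v $ j * (f z * matrix_inv (mat z - M) $ i $ j))"
      by (auto simp: matrix_vector_mult_def sum_distrib_left mult_ac)
    then show ?thesis
      using hol by (simp add: residue_sum[OF s(1,2)] residue_lmul[OF s(1,2)] holomorphic_on_mult mult.commute)
  qed
  then show ?thesis
    unfolding mat_fun_def matrix_vector_mult_def
    by (simp add: sum_distrib_right) (subst sum.swap, simp add: matrix_vector_mult_def)
qed

text \<open>Inserting the finite resolvent sum leaves residues of f(z) / (z - l)^(k+1) at l, which
  are Taylor coefficients of f. The case v = 0 is separate because \<open>l\<close> need not then be
  an eigenvalue, and \<open>f\<close> need not be analytic there.\<close>

lemma mat_fun_gen_eigenvector: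
  assumes f: "f analytic_on {l. eigenvalue_of M l}" and K: "shift_pow M l K v = 0"
  shows "mat_fun f M *v v = (\<Sum>k<K. ((deriv ^^ k) f l / fact k) *s shift_pow M l k v)"
proof (cases "v = 0")
  case False
  with K have l: "eigenvalue_of M l"
    using gen_eigenspace_eigenvalue by (auto simp: gen_eigenspace_def)
  have "(mat_fun f M *v v) $ i = (\<Sum>k<K. (deriv ^^ k) f l / fact k * shift_pow M l k v $ i)" for i
  proof -
    define g where "g z = f z * (\<Sum>k<K. (1 / (z - l) ^ Suc k) * shift_pow M l k v $ i)" for z
    have "residue (\<lambda>z. f z * (matrix_inv (mat z - M) *v v) $ i) l' = 
          (if l' = l then \<Sum>k<K. (deriv ^^ k) f l / fact k * shift_pow M l k v $ i else 0)"
      if l': "eigenvalue_of M l'" for l'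
    proof -
      obtain s where s: "open s" "l' \<in> s" "f holomorphic_on s" "s - {l'} \<subseteq> - {l. eigenvalue_of M l}"
        using analytic_at_eigenvalue_nbhd[OF f l'] by blast
      have "eventually (\<lambda>z. z \<in> s - {l'}) (at l')"
        using s(1,2) by (intro eventually_at_in_open) auto
      then have "eventually (\<lambda>z. f z * (matrix_inv (mat z - M) *v v) $ i = g z) (at l')"
      proof eventually_elim
        case (elim z)
        with s(4) have "\<not> eigenvalue_of M z" by auto
        with l have "z \<noteq> l" by auto
        then show ?case
          using resolvent_gen_eigenvector[OF K \<open>\<not> eigenvalue_of M z\<close>] by (simp add: g_def)
      qed
      then have "residue (\<lambda>z. f z * (matrix_inv (mat z - M) *v v) $ i) l' = residue g l'"
        by (intro residue_cong refl)
      also have "\<dots> = (if l' = l then \<Sum>k<K. (deriv ^^ k) f l / fact k * shift_pow M l k v $ i else 0)"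
      proof (cases "l' = l")
        case True
        have g: "g = (\<lambda>z. \<Sum>k<K. shift_pow M l k v $ i * (f z / (z - l) ^ Suc k))"
          by (auto simp: g_def sum_distrib_left mult_ac)
        have hol: "(\<lambda>z. f z / (z - l) ^ Suc k) holomorphic_on s - {l}" for k
          by (intro holomorphic_intros holomorphic_on_subset[OF s(3)]) auto
        have "residue g l' = (\<Sum>k<K. residue (\<lambda>z. shift_pow M l k v $ i * (f z / (z - l) ^ Suc k)) l)"
          unfolding g True
          using s(1,2) True by (intro residue_sum[of s] holomorphic_on_mult holomorphic_on_const hol) auto
        also have "\<dots> = (\<Sum>k<K. shift_pow M l k v $ i * ((deriv ^^ k) f l / fact k))"
          using s True
          by (intro sum.cong refl)
             (simp only: residue_lmul[OF _ _ hol] residue_holomorphic_over_power[of s l f])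
        finally show ?thesis using True by (simp add: mult.commute)
      next
        \<comment> \<open>At any other eigenvalue the singularity of the resolvent is invisible on
          v, so \<open>g\<close> is holomorphic there and has residue 0.\<close>
        case False
        have "g holomorphic_on s - {l}"
          unfolding g_def by (intro holomorphic_intros holomorphic_on_subset[OF s(3)]) auto
        then show ?thesis
          using False s residue_holo[of "s - {l}" l' g] by auto
      qed
      finally show ?thesis .
    qed
    then have "(mat_fun f M *v v) $ i = (\<Sum>l' | eigenvalue_of M l'.
        if l' = l then \<Sum>k<K. (deriv ^^ k) f l / fact k * shift_pow M l k v $ i else 0)"
      unfolding mat_fun_vec_component[OF f] by (intro sum.cong refl) simp
    then show ?thesis using l by (simp add: finite_eigenvalues)
  qed
  then show ?thesis by (simp add: vec_eq_iff)
qed simp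

section \<open>Algebraic rules of the functional calculus\<close>

lemma matrix_eqI_gen_eigenvectors:
  assumes "\<And>l K v. shift_pow M l K v = 0 \<Longrightarrow> X *v v = Y *v v"
  shows "X = (Y :: complex^'n^'m)"
proof -
  have "X *v v = Y *v v" for v
  proof (induction v rule: gen_eigenspaces_induct[where M = M])
    case (gen l v)
    then show ?case using assms by (auto simp: gen_eigenspace_def)
  qed (simp add: matrix_vector_right_distrib vector_scalar_commute)
  then show ?thesis by (simp add: matrix_eq)
qed

text \<open>By the Leibniz rule the Taylor coefficients of a product form the Cauchy product, and
  composing two truncated sums in the nilpotent map M - l gives the same double sum.\<close>

lemma mat_fun_mult:
  assumes f: "f analytic_on {l. eigenvalue_of M l}" and g: "g analytic_on {l. eigenvalue_of M l}"
  shows "mat_fun (\<lambda>w. f w * g w) M = mat_fun f M ** mat_fun g M"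
proof (rule matrix_eqI_gen_eigenvectors[of M])
  fix l K v assume K: "shift_pow M l K v = 0"
  show "mat_fun (\<lambda>w. f w * g w) M *v v = (mat_fun f M ** mat_fun g M) *v v"
  proof (cases "v = 0")
    case False
    with K have l: "eigenvalue_of M l"
      using gen_eigenspace_eigenvalue by (auto simp: gen_eigenspace_def)
    define a b where "a k = (deriv ^^ k) f l / fact k" and "b k = (deriv ^^ k) g l / fact k" for k
    define X where "X k = shift_pow M l k v" for k
    have X0: "X k = 0" if "k \<ge> K" for k
      using shift_pow_eq_0_mono[OF K that] by (simp add: X_def)
    have NX: "shift_pow M l i (X j) = X (i + j)" for i j
      by (simp add: X_def shift_pow_add)
    define u where "u = mat_fun g M *v v"
    have u: "u = (\<Sum>j<K. b j *s X j)"
      unfolding u_def mat_fun_gen_eigenvector[OF g K] by (simp add: b_def X_def)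
    have Nu: "shift_pow M l i u = (\<Sum>j<K. b j *s X (i + j))" for i
      by (simp add: u shift_pow_sum shift_pow_scale NX)
    have jet: "(deriv ^^ k) (\<lambda>w. f w * g w) l / fact k = (\<Sum>i\<le>k. a i * b (k - i))" for k
    proof -
      have "f analytic_on {l}" "g analytic_on {l}"
        using f g l by (auto intro: analytic_on_subset)
      then have "(deriv ^^ k) (\<lambda>w. f w * g w) l =
          (\<Sum>i\<le>k. of_nat (k choose i) * (deriv ^^ i) f l * (deriv ^^ (k - i)) g l)"
        by (simp add: higher_deriv_mult_at atLeast0AtMost)
      also have "\<dots> / fact k = (\<Sum>i\<le>k. a i * b (k - i))"
        by (auto simp: sum_divide_distrib a_def b_def binomial_fact intro!: sum.cong)
      finally show ?thesis .
    qed
    have "mat_fun f M *v u = (\<Sum>i<K. a i *s shift_pow M l i u)"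
      using X0 by (subst mat_fun_gen_eigenvector[OF f, of l K]) (simp_all add: Nu a_def)
    also have "\<dots> = (\<Sum>(i,j)\<in>{..<K}\<times>{..<K}. (a i * b j) *s X (i + j))"
      by (simp add: Nu vec.scale_sum_right sum.cartesian_product)
    \<comment> \<open>The pairs of the square with i + j >= K drop out by nilpotency; the remaining
      triangle is summed along diagonals.\<close>
    also have "\<dots> = (\<Sum>(i,j)\<in>{(i,j). i + j < K}. (a i * b j) *s X (i + j))"
      by (rule sum.mono_neutral_right) (auto, metis X0 not_less)
    also have "\<dots> = (\<Sum>k<K. \<Sum>i\<le>k. (a i * b (k - i)) *s X (i + (k - i)))"
      by (rule sum.triangle_reindex)
    also have "\<dots> = (\<Sum>k<K. (\<Sum>i\<le>k. a i * b (k - i)) *s X k)"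
      by (simp add: vec.scale_sum_left)
    also have "\<dots> = mat_fun (\<lambda>w. f w * g w) M *v v"
      using f g by (simp add: mat_fun_gen_eigenvector[OF _ K] analytic_on_mult jet X_def)
    finally show ?thesis by (simp add: u_def flip: matrix_vector_mul_assoc)
  qed simp
qed

lemma mat_fun_commute:
  assumes "f analytic_on {l. eigenvalue_of M l}" "g analytic_on {l. eigenvalue_of M l}"
  shows "mat_fun f M ** mat_fun g M = mat_fun g M ** mat_fun f M"
  using mat_fun_mult[OF assms] mat_fun_mult[OF assms(2,1)] by (simp add: mult.commute)

text \<open>Agreement near the spectrum is enough. This matters for Gamma identities, which hold
  only away from the poles.\<close>

lemma mat_fun_cong:
  assumes "\<And>l. eigenvalue_of M l \<Longrightarrow> eventually (\<lambda>w. f w = g w) (nhds l)"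
  shows "mat_fun f M = mat_fun g M"
proof -
  have "residue (\<lambda>z. f z * matrix_inv (mat z - M) $ i $ j) l =
        residue (\<lambda>z. g z * matrix_inv (mat z - M) $ i $ j) l" if "eigenvalue_of M l" for i j l
    using assms[OF that] by (intro residue_cong) (auto simp: eventually_nhds_conv_at elim: eventually_mono)
  then show ?thesis by (simp add: mat_fun_def vec_eq_iff)
qed

lemma mat_fun_shift: "mat_fun f (M + mat c) = mat_fun (\<lambda>w. f (w + c)) M"
proof -
  have res: "residue (\<lambda>z. f z * matrix_inv (mat z - (M + mat c)) $ i $ j) (l + c) =
        residue (\<lambda>z. f (z + c) * matrix_inv (mat z - M) $ i $ j) l" for i j l
  proof -
    have *: "mat (l + c + x) - (M + mat c) = mat (l + x) - M" for x
      by (simp flip: mat_add_mat)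
    show ?thesis
      unfolding residue_shift_0[of _ "l + c"] residue_shift_0[of _ l] *
      by (simp only: add_ac)
  qed
  have "bij_betw (\<lambda>l. l + c) {l. eigenvalue_of M l} {l. eigenvalue_of (M + mat c) l}"
    by (intro bij_betwI[where g = "\<lambda>l. l - c"]) (auto simp: eigenvalue_of_add)
  note reindex = sum.reindex_bij_betw[OF this, symmetric]
  show ?thesis
    unfolding mat_fun_def by (subst reindex) (simp add: res)
qed

lemma mat_fun_linear: "mat_fun (\<lambda>w. w + c) M = M + mat c"
proof (rule matrix_eqI_gen_eigenvectors[of M])
  fix l K v assume "shift_pow M l K v = 0"
  \<comment> \<open>The exponent is raised so that the sum surely contains the terms of index 0 and
    1, the only ones a linear function contributes.\<close>
  then have K: "shift_pow M l (Suc (Suc K)) v = 0" by (rule shift_pow_eq_0_mono) simp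
  have d1: "deriv (\<lambda>w. w + c) = (\<lambda>w. 1)" for c :: complex
    by (intro ext DERIV_imp_deriv) (auto intro!: derivative_eq_intros)
  have d0: "(deriv ^^ Suc 0) (\<lambda>w. w + c) l = 1"
    by (simp add: d1)
  have d2: "(deriv ^^ Suc (Suc k)) (\<lambda>w. w + c) = (\<lambda>w. 0)" for k
    by (simp only: funpow_Suc_right o_apply d1) simp
  have "mat_fun (\<lambda>w. w + c) M *v v = (l + c) *s v + shift_pow M l 1 v"
    by (subst mat_fun_gen_eigenvector[OF _ K])
       (auto intro!: analytic_intros simp: sum.lessThan_Suc_shift d0 d2 simp del: funpow.simps(2) sum.lessThan_Suc)
  also have "\<dots> = (M + mat c) *v v"
    using matrix_vector_shift_pow[of M l 0 v]
    by (simp add: matrix_vector_mult_add_rdistrib mat_mult_vec vec.scale_left_distrib)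
  finally show "mat_fun (\<lambda>w. w + c) M *v v = (M + mat c) *v v" .
qed

lemma mat_fun_ident: "mat_fun (\<lambda>w. w) M = M"
  using mat_fun_linear[of 0 M] by simp

lemma mat_fun_const: "mat_fun (\<lambda>w. c) M = mat c"
proof (rule matrix_eqI_gen_eigenvectors[of M])
  fix l K v assume "shift_pow M l K v = 0"
  then have K: "shift_pow M l (Suc K) v = 0" by (rule shift_pow_eq_0_mono) simp
  show "mat_fun (\<lambda>w. c) M *v v = mat c *v v"
    by (subst mat_fun_gen_eigenvector[OF _ K])
       (auto intro!: analytic_intros simp: sum.lessThan_Suc_shift mat_mult_vec simp del: funpow.simps(2) sum.lessThan_Suc)
qed

lemma mat_fun_power: "mat_fun (\<lambda>w. w ^ n) M = ((**) M ^^ n) (mat 1)"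
proof (induction n)
  case (Suc n)
  have "mat_fun (\<lambda>w. w ^ Suc n) M = mat_fun (\<lambda>w. w) M ** mat_fun (\<lambda>w. w ^ n) M"
    by (subst mat_fun_mult[symmetric]) (auto intro!: analytic_intros)
  with Suc show ?case by (simp add: mat_fun_ident)
qed (simp add: mat_fun_const)

section \<open>Exponential series and matrix powers\<close>

lemma bounded_linear_scalar_vec: "bounded_linear (\<lambda>v::complex^'n. c *s v)"
  and bounded_linear_vec_scalar: "bounded_linear (\<lambda>c::complex. c *s (v::complex^'n))"
proof -
  show "bounded_linear (\<lambda>v::complex^'n. c *s v)"
    using matrix_vector_mul_linear[of "mat c :: complex^'n^'n"]
    by (simp add: mat_mult_vec linear_conv_bounded_linear)
  have "linear (\<lambda>c::complex. c *s v)"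
    by (rule linearI) (simp_all add: vec.scale_left_distrib flip: of_real_scale, simp add: scaleR_conv_of_real)
  then show "bounded_linear (\<lambda>c::complex. c *s v)" by (simp add: linear_conv_bounded_linear)
qed

lemma tendsto_matrixI:
  fixes A :: "'b \<Rightarrow> complex^'n^'m"
  assumes "\<And>v. ((\<lambda>x. A x *v v) \<longlongrightarrow> B *v v) F"
  shows "(A \<longlongrightarrow> B) F"
proof (intro vec_tendstoI)
  fix i j
  have "((\<lambda>x. (A x *v axis j 1) $ i) \<longlongrightarrow> (B *v axis j 1) $ i) F"
    by (intro tendsto_vec_nth assms)
  then show "((\<lambda>x. A x $ i $ j) \<longlongrightarrow> B $ i $ j) F"
    by (simp add: matrix_axis_component)
qed

lemma sums_matrixI:
  fixes A :: "nat \<Rightarrow> complex^'n^'m"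
  assumes "\<And>v. (\<lambda>n. A n *v v) sums (B *v v)"
  shows "A sums B"
  using assms unfolding sums_def
  by (intro tendsto_matrixI) (simp add: matrix_vector_mult_sum_left)

text \<open>The k-th Taylor coefficient at l of exp(a w), obtained from the exponential series term
  by term.\<close>

lemma sums_exp_jet:
  "(\<lambda>n. a ^ n / fact n * ((deriv ^^ k) (\<lambda>w. w ^ n) l / fact k)) sums (a ^ k * exp (a * l) / (fact k :: complex))"
proof -
  have d: "(deriv ^^ k) (\<lambda>w. w ^ n) l = pochhammer (of_nat (Suc n - k)) k * l ^ (n - k)" for n
    using higher_deriv_power[of k 0 n l] by simp
  \<comment> \<open>For n < k the truncated difference \<open>Suc n - k\<close> is 0 and k > 0, so
    the Pochhammer factor vanishes.\<close>
  have 0: "a ^ n / fact n * ((deriv ^^ k) (\<lambda>w. w ^ n) l / fact k) = 0" if "n < k" for n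
  proof -
    have "Suc n - k = 0" using that by simp
    then show ?thesis using that by (simp add: d pochhammer_0_left)
  qed
  have poch: "pochhammer (1 + of_nat m) k = (fact (m + k) / fact m :: complex)" for m
    using pochhammer_product'[of "1::complex" m k] by (simp add: field_simps flip: pochhammer_fact)
  have shift: "a ^ (m + k) / fact (m + k) * ((deriv ^^ k) (\<lambda>w. w ^ (m + k)) l / fact k)
      = a ^ k / fact k * ((a * l) ^ m /\<^sub>R fact m)" for m
    by (simp only: d) (simp add: poch power_add power_mult_distrib scaleR_conv_of_real field_simps)
  have "(\<lambda>m. a ^ k / fact k * ((a * l) ^ m /\<^sub>R fact m)) sums (a ^ k / fact k * exp (a * l))"
    by (intro sums_mult exp_converges)
  then have "(\<lambda>n. a ^ n / fact n * ((deriv ^^ k) (\<lambda>w. w ^ n) l / fact k)) sums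
      (a ^ k / fact k * exp (a * l) + (\<Sum>n<k. a ^ n / fact n * ((deriv ^^ k) (\<lambda>w. w ^ n) l / fact k)))"
    by (subst sums_iff_shift'[of _ k, symmetric]) (simp only: shift add_diff_cancel_right')
  moreover have "(\<Sum>n<k. a ^ n / fact n * ((deriv ^^ k) (\<lambda>w. w ^ n) l / fact k)) = 0"
    by (intro sum.neutral ballI 0) simp
  ultimately show ?thesis by simp
qed

text \<open>Links the power series that defines \<open>mat_exp\<close> to the residue calculus: on a
  generalized eigenvector each matrix power is a finite sum of jets, and these are summed over n for
  each fixed k.\<close>

lemma mat_exp_eq_mat_fun: "mat_exp (a *\<^sub>R M) = mat_fun (\<lambda>w. exp (of_real a * w)) M"
proof -
  have pow: "(((**) (a *\<^sub>R M)) ^^ n) (mat 1) = a ^ n *\<^sub>R (((**) M ^^ n) (mat 1))" for n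
    by (induction n) (simp_all add: matrix_scalar_ac mult.commute flip: scalar_matrix_assoc)
  define A where "A n = (1 / fact n) *\<^sub>R (((**) (a *\<^sub>R M)) ^^ n) (mat 1)" for n
  have "(\<lambda>n. A n *v v) sums (mat_fun (\<lambda>w. exp (of_real a * w)) M *v v)" for v
  proof (induction v rule: gen_eigenspaces_induct[where M = M])
    case (gen l v)
    then obtain K where K: "shift_pow M l K v = 0" by (auto simp: gen_eigenspace_def)
    have "(deriv ^^ k) exp = (exp :: complex \<Rightarrow> complex)" for k
      by (induction k) (auto intro!: DERIV_imp_deriv)
    then have dexp: "(deriv ^^ k) (\<lambda>w. exp (of_real a * w)) l = of_real a ^ k * exp (of_real a * l)" for k
      using higher_deriv_compose_linear[of exp UNIV UNIV l "of_real a" k] by (simp add: holomorphic_on_exp)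
    have A: "A n *v v = (\<Sum>k<K. (of_real a ^ n / fact n * ((deriv ^^ k) (\<lambda>w. w ^ n) l / fact k)) *s shift_pow M l k v)" for n
    proof -
      have "A n *v v = (of_real (a ^ n / fact n)) *s (mat_fun (\<lambda>w. w ^ n) M *v v)"
        by (simp only: of_real_scale) (simp add: A_def pow mat_fun_power scaleR_matrix_vector)
      also have "\<dots> = (of_real a ^ n / fact n) *s
          (\<Sum>k<K. ((deriv ^^ k) (\<lambda>w. w ^ n) l / fact k) *s shift_pow M l k v)"
        by (subst mat_fun_gen_eigenvector[OF _ K]) (auto intro!: analytic_intros)
      finally show ?thesis by (simp add: vec.scale_sum_right)
    qed
    have "(\<lambda>n. A n *v v) sums (\<Sum>k<K. (of_real a ^ k * exp (of_real a * l) / fact k) *s shift_pow M l k v)"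
      unfolding A by (intro sums_sum bounded_linear.sums[OF bounded_linear_vec_scalar] sums_exp_jet)
    also have "(\<Sum>k<K. (of_real a ^ k * exp (of_real a * l) / fact k) *s shift_pow M l k v)
        = mat_fun (\<lambda>w. exp (of_real a * w)) M *v v"
      by (subst mat_fun_gen_eigenvector[OF _ K]) (auto intro!: analytic_intros simp: dexp)
    finally show ?case .
  next
    case (scale_add c v w)
    then show ?case
      by (simp add: matrix_vector_right_distrib vector_scalar_commute)
         (intro sums_add bounded_linear.sums[OF bounded_linear_scalar_vec])
  qed
  then have "A sums mat_fun (\<lambda>w. exp (of_real a * w)) M" by (rule sums_matrixI)
  then have "suminf A = mat_fun (\<lambda>w. exp (of_real a * w)) M" by (simp add: sums_iff)
  then show ?thesis unfolding mat_exp_def A_def[symmetric] .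
qed

lemma mat_powr_eq_mat_fun: "t > 0 \<Longrightarrow> mat_powr t M = mat_fun (\<lambda>w. of_real t powr w) M"
  by (simp add: mat_powr_def mat_exp_eq_mat_fun powr_def mult.commute Ln_of_real)

section \<open>The logarithmic moments of the beta integral\<close>

text \<open>The beta integral on [0, 1] rescaled by t = z x. The kernel is nonnegative, so the gauge
  integral upgrades to a Lebesgue integral.\<close>

lemma real_beta_kernel:
  fixes z p q :: real
  assumes z: "z > 0" and p: "p > 0" and q: "q > 0"
  shows "set_integrable lborel {0<..<z} (\<lambda>t. (z - t) powr (p - 1) * t powr (q - 1))" (is ?int)
    and "(LINT t:{0<..<z}|lborel. (z - t) powr (p - 1) * t powr (q - 1)) = z powr (p + q - 1) * Beta q p" (is ?eq)
proof -
  let ?g = "\<lambda>t. (z - t) powr (p - 1) * t powr (q - 1)"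
  have img: "(\<lambda>x. x * z) ` {0..1} = {0..z}"
    using z by (auto simp: image_iff mult_le_cancel_right1 intro!: bexI[of _ "_ / z"])
  have "((\<lambda>t. (1/z * t) powr (q - 1) * (1 - 1/z * t) powr (p - 1)) has_integral z * Beta q p) {0..z}"
    using has_integral_affinity[of "\<lambda>t. t powr (q - 1) * (1 - t) powr (p - 1)" "Beta q p" 0 1 "1/z" 0]
      has_integral_Beta_real[OF q p] z img by (simp add: mult.commute)
  then have "((\<lambda>t. z powr (p + q - 2) * ((1/z * t) powr (q - 1) * (1 - 1/z * t) powr (p - 1))) has_integral
      z powr (p + q - 2) * (z * Beta q p)) {0..z}"
    by (rule has_integral_mult_right)
  moreover have "z powr (p + q - 2) * ((1/z * t) powr (q - 1) * (1 - 1/z * t) powr (p - 1)) = ?g t"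
    if "t \<in> {0..z}" for t
  proof -
    have "1 - 1/z * t = (z - t) / z" using z by (simp add: field_simps)
    moreover have "z powr (p + q - 2) = z powr (q - 1) * z powr (p - 1)"
      by (simp add: add.commute flip: powr_add)
    ultimately show ?thesis using z that by (simp add: powr_divide)
  qed
  moreover have "z powr (p + q - 2) * z = z powr (p + q - 1)"
    using z powr_add[of z "p + q - 2" 1] by simp
  ultimately have "(?g has_integral z powr (p + q - 1) * Beta q p) {0..z}"
    unfolding mult.assoc[symmetric] by (metis (no_types, lifting) has_integral_cong)
  then have g: "(?g has_integral z powr (p + q - 1) * Beta q p) {0<..<z}"
    by (simp add: has_integral_Icc_iff_Ioo)
  then have "?g absolutely_integrable_on {0<..<z}"
    by (subst absolutely_integrable_on_iff_nonneg) auto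
  then show ?int
    unfolding set_integrable_def by (subst (asm) integrable_completion) auto
  then show ?eq
    using g set_borel_integral_eq_integral(2) by (metis integral_unique)
qed

section \<open>Beta kernels with logarithmic factors and their analytic dependence on the
  exponent\<close>

definition beta_kernel :: "real \<Rightarrow> complex \<Rightarrow> complex \<Rightarrow> nat \<Rightarrow> real \<Rightarrow> complex" where
  "beta_kernel z \<mu> a k t =
     of_real (z - t) powr (\<mu> - 1) * of_real t powr (a - 1) * of_real (ln t) ^ k"

definition beta_moment :: "real \<Rightarrow> complex \<Rightarrow> complex \<Rightarrow> nat \<Rightarrow> complex" where
  "beta_moment z \<mu> a k = (LINT t:{0<..<z}|lborel. beta_kernel z \<mu> a k t)"

lemma norm_beta_kernel:
  "t \<in> {0<..<z} \<Longrightarrow> norm (beta_kernel z \<mu> a k t) = (z - t) powr (Re \<mu> - 1) * t powr (Re a - 1) * \<bar>ln t\<bar> ^ k"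
  by (simp add: beta_kernel_def norm_mult norm_power norm_powr_real_powr)

lemma set_measurable_beta_kernel: "set_borel_measurable lborel {0<..<z} (beta_kernel z \<mu> a k)"
proof -
  have "continuous_on {0<..<z} (beta_kernel z \<mu> a k)"
    unfolding beta_kernel_def by (intro continuous_intros) auto
  then have "set_borel_measurable borel {0<..<z} (beta_kernel z \<mu> a k)"
    by (intro set_measurable_continuous_on) auto
  then show ?thesis by (simp add: set_borel_measurable_def)
qed

lemma exp_abs_ln_le: "t > 0 \<Longrightarrow> exp (e * \<bar>ln t\<bar>) \<le> t powr e + t powr (- e)" for t e :: real
  by (cases "ln t \<ge> 0") (auto simp: powr_def)

text \<open>A single term of the exponential series is at most its sum: x^k / k! <= exp x at x = e
  |ln t|. Logarithms are thus paid for with an arbitrarily small power of t.\<close>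

lemma abs_ln_power_le:
  fixes t e :: real
  assumes "t > 0" "e > 0"
  shows "\<bar>ln t\<bar> ^ k \<le> fact k / e ^ k * (t powr e + t powr (- e))"
proof -
  have "(e * \<bar>ln t\<bar>) ^ k /\<^sub>R fact k \<le> (\<Sum>i. (e * \<bar>ln t\<bar>) ^ i /\<^sub>R fact i)"
    using assms summable_exp_generic[of "e * \<bar>ln t\<bar>"]
      sum_le_suminf[of "\<lambda>i. (e * \<bar>ln t\<bar>) ^ i /\<^sub>R fact i" "{k}"] by simp
  then have "(e * \<bar>ln t\<bar>) ^ k / fact k \<le> exp (e * \<bar>ln t\<bar>)"
    by (simp add: exp_def divide_inverse mult.commute)
  also have "\<dots> \<le> t powr e + t powr (- e)" using assms by (intro exp_abs_ln_le)
  finally show ?thesis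
    using assms by (simp add: power_mult_distrib field_simps)
qed

lemma set_integrable_beta_dominator:
  fixes z p q e :: real
  assumes "z > 0" "p > 0" "\<bar>e\<bar> < q"
  shows "set_integrable lborel {0<..<z}
    (\<lambda>t. (z - t) powr (p - 1) * t powr (q - 1) * (t powr e + t powr (- e)))"
proof -
  have "set_integrable lborel {0<..<z}
    (\<lambda>t. (z - t) powr (p - 1) * t powr (q + e - 1) + (z - t) powr (p - 1) * t powr (q + (- e) - 1))"
    using assms by (intro set_integral_add real_beta_kernel) auto
  moreover have "(z - t) powr (p - 1) * t powr (q - 1) * (t powr e + t powr (- e)) =
     (z - t) powr (p - 1) * t powr (q + e - 1) + (z - t) powr (p - 1) * t powr (q + (- e) - 1)" for t
  proof -
    have "t powr (q + e - 1) = t powr (q - 1) * t powr e" for e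
      by (simp add: algebra_simps flip: powr_add)
    then show ?thesis by (simp only: distrib_left mult.assoc)
  qed
  ultimately show ?thesis by simp
qed

lemma set_integrable_beta_kernel:
  assumes z: "z > 0" and mu: "Re \<mu> > 0" and a: "Re a > 0"
  shows "set_integrable lborel {0<..<z} (beta_kernel z \<mu> a k)"
proof (rule set_integrable_bound)
  \<comment> \<open>Any exponent strictly between 0 and Re a keeps t^(a - 1 - e) integrable at
    0.\<close>
  define e where "e = Re a / 2"
  have e: "e > 0" "\<bar>e\<bar> < Re a" using a by (auto simp: e_def)
  define C where "C = fact k / e ^ k"
  show "set_integrable lborel {0<..<z}
    (\<lambda>t. C * ((z - t) powr (Re \<mu> - 1) * t powr (Re a - 1) * (t powr e + t powr (- e))))"
    by (intro set_integrable_mult_right set_integrable_beta_dominator z mu e)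
  have "norm (beta_kernel z \<mu> a k t) \<le>
      norm (C * ((z - t) powr (Re \<mu> - 1) * t powr (Re a - 1) * (t powr e + t powr (- e))))"
    if t: "t \<in> {0<..<z}" for t
  proof -
    have "\<bar>ln t\<bar> ^ k \<le> C * (t powr e + t powr (- e))"
      unfolding C_def using e t by (intro abs_ln_power_le) auto
    then have "(z - t) powr (Re \<mu> - 1) * t powr (Re a - 1) * \<bar>ln t\<bar> ^ k \<le>
        (z - t) powr (Re \<mu> - 1) * t powr (Re a - 1) * (C * (t powr e + t powr (- e)))"
      by (intro mult_left_mono) auto
    then show ?thesis
      unfolding norm_beta_kernel[OF t] by (simp add: mult_ac)
  qed
  then show "AE t in lborel. t \<in> {0<..<z} \<longrightarrow> norm (beta_kernel z \<mu> a k t) \<le>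
      norm (C * ((z - t) powr (Re \<mu> - 1) * t powr (Re a - 1) * (t powr e + t powr (- e))))"
    by auto
qed (rule set_measurable_beta_kernel)

text \<open>Expand t^h = exp(h ln t) and integrate term by term. All partial sums are dominated with
  t^|h| + t^(-|h|) in place of the exponential, which is integrable against the kernel because |h| <
  Re a.\<close>

lemma beta_moment_power_series:
  assumes z: "z > 0" and mu: "Re \<mu> > 0" and h: "norm h < Re a"
  shows "(\<lambda>k. beta_moment z \<mu> a k / fact k * h ^ k) sums beta_moment z \<mu> (a + h) 0"
proof -
  have a: "Re a > 0" using h norm_ge_zero[of h] by linarith
  define s where "s i t = (\<Sum>k<i. beta_kernel z \<mu> a k t / fact k * h ^ k)" for i t
  define w where "w t = (z - t) powr (Re \<mu> - 1) * t powr (Re a - 1) * (t powr norm h + t powr (- norm h))" for t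
  have s_int: "set_integrable lborel {0<..<z} (\<lambda>t. beta_kernel z \<mu> a k t / fact k * h ^ k)" for k
    using set_integrable_beta_kernel[OF z mu a, of k] by auto
  have s_int_eq: "(LINT t:{0<..<z}|lborel. s i t) = (\<Sum>k<i. beta_moment z \<mu> a k / fact k * h ^ k)" for i
  proof -
    have "(LINT t:{0<..<z}|lborel. s i t) =
        (\<Sum>k<i. LINT t:{0<..<z}|lborel. beta_kernel z \<mu> a k t / fact k * h ^ k)"
      using s_int unfolding s_def set_lebesgue_integral_def set_integrable_def scaleR_sum_right
      by (rule Bochner_Integration.integral_sum)
    then show ?thesis by (simp add: beta_moment_def)
  qed
  have lim: "(\<lambda>i. s i t) \<longlonglongrightarrow> beta_kernel z \<mu> (a + h) 0 t" if t: "t \<in> {0<..<z}" for t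
  proof -
    have "(\<lambda>k. (h * of_real (ln t)) ^ k /\<^sub>R fact k) sums exp (h * of_real (ln t))"
      by (rule exp_converges)
    then have "(\<lambda>k. beta_kernel z \<mu> a 0 t * ((h * of_real (ln t)) ^ k /\<^sub>R fact k)) sums
        (beta_kernel z \<mu> a 0 t * exp (h * of_real (ln t)))"
      by (rule sums_mult)
    moreover have "beta_kernel z \<mu> a 0 t * exp (h * of_real (ln t)) = beta_kernel z \<mu> (a + h) 0 t"
      using t by (simp add: beta_kernel_def powr_def Ln_of_real algebra_simps exp_add exp_diff)
    moreover have "beta_kernel z \<mu> a 0 t * ((h * of_real (ln t)) ^ k /\<^sub>R fact k) =
        beta_kernel z \<mu> a k t / fact k * h ^ k" for k
      by (simp add: beta_kernel_def power_mult_distrib scaleR_conv_of_real field_simps)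
    ultimately show ?thesis by (simp add: sums_def s_def)
  qed
  have bound: "norm (s i t) \<le> w t" if t: "t \<in> {0<..<z}" for i t
  proof -
    have "norm (s i t) \<le> (\<Sum>k<i. norm (beta_kernel z \<mu> a k t / fact k * h ^ k))"
      unfolding s_def by (rule norm_sum)
    also have "\<dots> = (z - t) powr (Re \<mu> - 1) * t powr (Re a - 1) * (\<Sum>k<i. (norm h * \<bar>ln t\<bar>) ^ k /\<^sub>R fact k)"
      unfolding sum_distrib_left
      using t by (intro sum.cong refl) (simp add: norm_mult norm_divide norm_power norm_beta_kernel power_mult_distrib field_simps)
    also have "(\<Sum>k<i. (norm h * \<bar>ln t\<bar>) ^ k /\<^sub>R fact k) \<le> exp (norm h * \<bar>ln t\<bar>)"
      unfolding exp_def by (rule sum_le_suminf[OF summable_exp_generic]) auto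
    also have "\<dots> \<le> t powr norm h + t powr (- norm h)"
      using t by (intro exp_abs_ln_le) auto
    finally show ?thesis by (simp add: w_def mult_left_mono)
  qed
  have "(\<lambda>i. LINT t:{0<..<z}|lborel. s i t) \<longlonglongrightarrow> beta_moment z \<mu> (a + h) 0"
    unfolding beta_moment_def set_lebesgue_integral_def
  proof (rule integral_dominated_convergence[where w = "\<lambda>t. indicator {0<..<z} t *\<^sub>R w t"])
    show "integrable lborel (\<lambda>t. indicator {0<..<z} t *\<^sub>R w t)"
      using set_integrable_beta_dominator[of z "Re \<mu>" "norm h" "Re a"] z mu h
      by (simp add: set_integrable_def w_def)
    show "(\<lambda>t. indicator {0<..<z} t *\<^sub>R s i t) \<in> borel_measurable lborel" for i
      using s_int unfolding s_def set_integrable_def scaleR_sum_right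
      by (intro borel_measurable_integrable Bochner_Integration.integrable_sum)
    show "(\<lambda>t. indicator {0<..<z} t *\<^sub>R beta_kernel z \<mu> (a + h) 0 t) \<in> borel_measurable lborel"
      using set_measurable_beta_kernel by (simp add: set_borel_measurable_def)
    show "AE t in lborel. (\<lambda>i. indicator {0<..<z} t *\<^sub>R s i t) \<longlonglongrightarrow>
        indicator {0<..<z} t *\<^sub>R beta_kernel z \<mu> (a + h) 0 t"
      using lim by (intro AE_I2) (auto simp: indicator_def)
    show "AE t in lborel. norm (indicator {0<..<z} t *\<^sub>R s i t) \<le> indicator {0<..<z} t *\<^sub>R w t" for i
      using bound by (intro AE_I2) (auto simp: indicator_def)
  qed
  then show ?thesis by (simp add: s_int_eq sums_def)
qed

text \<open>The expansion in h already is a Taylor series, so analyticity and all derivatives are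
  read off from its coefficients without differentiating under the integral.\<close>

lemma
  assumes z: "z > 0" and mu: "Re \<mu> > 0" and a: "Re a > 0"
  shows beta_moment_analytic: "(\<lambda>w. beta_moment z \<mu> w 0) analytic_on {a}"
    and higher_deriv_beta_moment: "(deriv ^^ k) (\<lambda>w. beta_moment z \<mu> w 0) a = beta_moment z \<mu> a k"
proof -
  define f where "f h = beta_moment z \<mu> (a + h) 0" for h
  define F where "F = Abs_fps (\<lambda>k. beta_moment z \<mu> a k / fact k)"
  have "eventually (\<lambda>h. h \<in> ball 0 (Re a)) (nhds 0)"
    using a by (intro eventually_nhds_in_open) auto
  then have "eventually (\<lambda>h. (\<lambda>k. fps_nth F k * h ^ k) sums f h) (nhds 0)"
    by eventually_elim (use beta_moment_power_series[OF z mu] in \<open>auto simp: F_def f_def\<close>)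
  then have F: "f has_fps_expansion F" by (rule has_fps_expansionI)
  then have f: "f analytic_on {0}" by (rule has_fps_expansion_imp_analytic_0)
  have "f \<circ> (\<lambda>w. w - a) analytic_on {a}"
    using f by (intro analytic_on_compose analytic_intros) auto
  then show an: "(\<lambda>w. beta_moment z \<mu> w 0) analytic_on {a}" by (simp add: f_def o_def)
  obtain e where e: "e > 0" "(\<lambda>w. beta_moment z \<mu> w 0) holomorphic_on ball a e"
    using an by (auto simp: analytic_on_def)
  have "(deriv ^^ k) (\<lambda>w. beta_moment z \<mu> (1 * w + a) 0) 0 = 1 ^ k * (deriv ^^ k) (\<lambda>w. beta_moment z \<mu> w 0) (1 * 0 + a)"
    by (rule higher_deriv_compose_linear'[where S = "ball 0 e", OF e(2)]) (use e in \<open>auto simp: dist_norm\<close>)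
  moreover have "f = (\<lambda>w. beta_moment z \<mu> (1 * w + a) 0)" by (intro ext) (simp add: f_def add.commute)
  ultimately have "(deriv ^^ k) (\<lambda>w. beta_moment z \<mu> w 0) a = (deriv ^^ k) f 0" by simp
  also have "\<dots> = beta_moment z \<mu> a k"
    using fps_nth_fps_expansion[OF F, of k] by (simp add: F_def)
  finally show "(deriv ^^ k) (\<lambda>w. beta_moment z \<mu> w 0) a = beta_moment z \<mu> a k" .
qed

text \<open>Substitution of z - t for t. It lets the continuation in the first exponent be reduced
  to the one in the second.\<close>

lemma beta_moment_commute: "beta_moment z \<mu> a 0 = beta_moment z a \<mu> 0"
proof -
  have "beta_moment z \<mu> a 0 = (\<integral>t. indicator {0<..<z} (z + (-1) * t) *\<^sub>R beta_kernel z \<mu> a 0 (z + (-1) * t) \<partial>lborel)"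
    unfolding beta_moment_def set_lebesgue_integral_def
    by (subst lborel_integral_real_affine[of "-1" _ z]) auto
  also have "\<dots> = beta_moment z a \<mu> 0"
    unfolding beta_moment_def set_lebesgue_integral_def
    by (intro Bochner_Integration.integral_cong refl) (auto simp: indicator_def beta_kernel_def)
  finally show ?thesis .
qed

lemma halfplane_identity:
  fixes f g :: "complex \<Rightarrow> complex"
  assumes "f holomorphic_on {w. Re w > 0}" "g holomorphic_on {w. Re w > 0}"
    and "\<And>x::real. x > 0 \<Longrightarrow> f (of_real x) = g (of_real x)" and "Re a > 0"
  shows "f a = g a"
proof -
  have "f a - g a = 0"
  proof (rule analytic_continuation[where f = "\<lambda>w. f w - g w" and S = "{w. Re w > 0}" and \<xi> = 1])
    show "(\<lambda>w. f w - g w) holomorphic_on {w. Re w > 0}" using assms by (intro holomorphic_intros)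
    show "open {w. Re w > 0}" by (rule open_halfspace_Re_gt)
    show "connected {w. Re w > 0}" by (intro convex_connected convex_halfspace_Re_gt)
    show "complex_of_real ` {0<..} \<subseteq> {w. Re w > 0}" by auto
    show "1 islimpt (complex_of_real ` {0<..})"
      unfolding islimpt_approachable
    proof (intro allI impI)
      fix e :: real assume "e > 0"
      then have "dist (complex_of_real (1 + e / 2)) 1 < e" by (simp add: dist_norm)
      with \<open>e > 0\<close> show "\<exists>x'\<in>complex_of_real ` {0<..}. x' \<noteq> 1 \<and> dist x' 1 < e"
        by (intro bexI[of _ "complex_of_real (1 + e / 2)"] imageI) (auto simp: complex_eq_iff)
    qed
  qed (use assms in auto)
  then show ?thesis by simp
qed

text \<open>The formula is known for two positive real exponents and is extended to the right half
  plane in one variable at a time by the identity theorem.\<close>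

lemma beta_moment_closed_form:
  assumes z: "z > 0" and mu: "Re \<mu> > 0" and a: "Re a > 0"
  shows "beta_moment z \<mu> a 0 = of_real z powr (a + \<mu> - 1) * Gamma a * Gamma \<mu> * rGamma (a + \<mu>)"
proof -
  let ?H = "\<lambda>\<mu> a. of_real z powr (a + \<mu> - 1) * Gamma a * Gamma \<mu> * rGamma (a + \<mu>)"
  have H_holo: "?H \<mu> holomorphic_on {w. Re w > 0}" for \<mu>
    using z by (intro holomorphic_intros) (auto elim!: nonpos_Ints_cases)
  have m_holo: "(\<lambda>w. beta_moment z \<mu> w 0) holomorphic_on {w. Re w > 0}" if "Re \<mu> > 0" for \<mu>
    using beta_moment_analytic[OF z that]
    by (intro analytic_imp_holomorphic) (simp add: analytic_on_analytic_at[of _ "{w. Re w > 0}"])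
  have powr_minus_1: "complex_of_real x powr (of_real p - 1) = of_real (x powr (p - 1))" if "x \<ge> 0" for x p
    using powr_of_real[OF that, of "p - 1"] by simp
  have real: "beta_moment z (of_real p) (of_real q) 0 = ?H (of_real p) (of_real q)"
    if "p > 0" "q > 0" for p q :: real
  proof -
    have "beta_moment z (of_real p) (of_real q) 0 =
        (LINT t:{0<..<z}|lborel. complex_of_real ((z - t) powr (p - 1) * t powr (q - 1)))"
      unfolding beta_moment_def
      using powr_minus_1
      by (intro set_lebesgue_integral_cong) (auto simp: beta_kernel_def simp del: of_real_diff)
    also have "\<dots> = of_real (z powr (p + q - 1) * Beta q p)"
      unfolding set_integral_complex_of_real real_beta_kernel(2)[OF z that] ..
    also have "\<dots> = ?H (of_real p) (of_real q)"
    proof -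
      have "complex_of_real (z powr (p + q - 1)) = of_real z powr (of_real q + of_real p - 1)"
        using powr_minus_1[of z "p + q"] z by (simp add: add.commute)
      then show ?thesis
        by (simp add: Beta_def rGamma_inverse_Gamma divide_inverse add.commute flip: Gamma_complex_of_real)
    qed
    finally show ?thesis .
  qed
  \<comment> \<open>First continuation: \<open>p\<close> stays real while \<open>a\<close> becomes
    complex.\<close>
  have "beta_moment z (of_real p) a 0 = ?H (of_real p) a" if "p > 0" "Re a > 0" for p a
  proof (rule halfplane_identity[where f = "\<lambda>a. beta_moment z (of_real p) a 0" and g = "?H (of_real p)"])
    show "(\<lambda>a. beta_moment z (of_real p) a 0) holomorphic_on {w. Re w > 0}"
      by (rule m_holo) (use that in simp)
    show "beta_moment z (of_real p) (of_real x) 0 = ?H (of_real p) (of_real x)" if "x > 0" for x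
      by (rule real) fact+
  qed (rule H_holo \<open>Re a > 0\<close>)+
  \<comment> \<open>With the roles exchanged by symmetry, the fixed exponent is now the complex
    \<open>a\<close>, and the real one is continued to \<mu>.\<close>
  then have "beta_moment z a (of_real p) 0 = ?H a (of_real p)" if "p > 0" for p
    using that a unfolding beta_moment_commute[of z a] by (simp add: add.commute mult_ac)
  then have "beta_moment z a \<mu> 0 = ?H a \<mu>"
    by (rule halfplane_identity[where f = "\<lambda>\<mu>. beta_moment z a \<mu> 0" and g = "?H a", OF m_holo[OF a] H_holo _ mu])
  then show ?thesis
    unfolding beta_moment_commute[of z \<mu>] by (simp add: add.commute mult_ac)
qed

lemma beta_moment_eq_higher_deriv:
  assumes z: "z > 0" and mu: "Re \<mu> > 0" and l: "Re (l + c) > 0"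
  shows "beta_moment z \<mu> (l + c) k = (deriv ^^ k) (\<lambda>w. Gamma \<mu> *
    (of_real z powr (w + c + \<mu> - 1) * Gamma (w + c) * rGamma (w + c + \<mu>))) l"
proof -
  let ?H = "\<lambda>w. Gamma \<mu> * (of_real z powr (w + c + \<mu> - 1) * Gamma (w + c) * rGamma (w + c + \<mu>))"
  let ?m = "\<lambda>w. beta_moment z \<mu> w 0"
  obtain e where e: "e > 0" "?m holomorphic_on ball (l + c) e"
    using beta_moment_analytic[OF z mu l] by (auto simp: analytic_on_def)
  have "beta_moment z \<mu> (l + c) k = (deriv ^^ k) ?m (1 * l + c)"
    using higher_deriv_beta_moment[OF z mu l] by simp
  also have "\<dots> = (deriv ^^ k) (\<lambda>w. ?m (1 * w + c)) l"
    by (subst higher_deriv_compose_linear'[where S = "ball l e", OF e(2)]) (use e in \<open>auto simp: dist_norm\<close>)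
  also have "\<dots> = (deriv ^^ k) ?H l"
  proof (rule higher_deriv_cong_ev)
    have "open {w. Re (w + c) > 0}"
      by (intro open_Collect_less continuous_intros)
    then have "eventually (\<lambda>w. w \<in> {w. Re (w + c) > 0}) (nhds l)"
      using l by (intro eventually_nhds_in_open) auto
    then show "eventually (\<lambda>w. ?m (1 * w + c) = ?H w) (nhds l)"
      by eventually_elim (simp add: beta_moment_closed_form[OF z mu] mult_ac)
  qed simp
  finally show ?thesis .
qed

section \<open>Term-by-term integration\<close>

lemma bounded_bilinear_matrix_vector: "bounded_bilinear ((*v) :: complex^'n^'m \<Rightarrow> complex^'n \<Rightarrow> complex^'m)"
proof -
  have "bilinear ((*v) :: complex^'n^'m \<Rightarrow> complex^'n \<Rightarrow> complex^'m)"
    unfolding bilinear_def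
    by (auto intro!: linearI simp: matrix_vector_mult_add_rdistrib scaleR_matrix_vector)
  then show ?thesis by (simp add: bilinear_conv_bounded_bilinear)
qed

lemmas bounded_linear_matrix_vector_left = bounded_bilinear.bounded_linear_left[OF bounded_bilinear_matrix_vector]

lemma summable_matrixI:
  fixes A :: "nat \<Rightarrow> complex^'n^'m"
  assumes "\<And>v. summable (\<lambda>n. A n *v v)"
  shows "summable A"
proof -
  have "(\<lambda>n. (\<Sum>i<n. A i) $ i $ j) \<longlonglongrightarrow> (\<Sum>n. A n *v axis j 1) $ i" for i j
  proof -
    have "(\<lambda>n. (\<Sum>i<n. A i *v axis j 1) $ i) \<longlonglongrightarrow> (\<Sum>n. A n *v axis j 1) $ i"
      by (intro tendsto_vec_nth summable_LIMSEQ assms)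
    then show ?thesis by (simp add: matrix_axis_component flip: matrix_vector_mult_sum_left)
  qed
  then have "(\<lambda>n. \<Sum>i<n. A i) \<longlonglongrightarrow> (\<chi> i j. (\<Sum>n. A n *v axis j 1) $ i)"
    by (intro vec_tendstoI) simp
  then show ?thesis by (auto simp: summable_def sums_def)
qed

lemma set_integrable_matrix_vector:
  fixes F :: "'a \<Rightarrow> complex^'n^'m"
  assumes "set_integrable M S F"
  shows "set_integrable M S (\<lambda>t. F t *v v)"
    and "(LINT t:S|M. F t *v v) = (LINT t:S|M. F t) *v v"
  using integrable_bounded_linear[OF bounded_linear_matrix_vector_left[of v], of M "\<lambda>t. indicator S t *\<^sub>R F t"]
    integral_bounded_linear[OF bounded_linear_matrix_vector_left[of v], of M "\<lambda>t. indicator S t *\<^sub>R F t"] assms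
  by (simp_all add: set_integrable_def set_lebesgue_integral_def scaleR_matrix_vector)

text \<open>\<open>L j\<close> puts a vector into column \<open>j\<close> of a zero matrix, so a
  matrix is recovered linearly from its images of the unit vectors.\<close>

lemma set_integrable_matrixI:
  fixes F :: "'a \<Rightarrow> complex^'n^'m"
  assumes "\<And>v. set_integrable M S (\<lambda>t. F t *v v)"
  shows "set_integrable M S F"
proof -
  define L where "L j x = (\<chi> i j'. if j' = j then x $ i else (0::complex))" for j :: 'n and x :: "complex^'m"
  have L: "bounded_linear (L j)" for j
  proof -
    have "linear (L j)" by (intro linearI) (auto simp: L_def vec_eq_iff)
    then show ?thesis by (simp add: linear_conv_bounded_linear)
  qed
  have F: "X = (\<Sum>j\<in>UNIV. L j (X *v axis j 1))" for X :: "complex^'n^'m"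
    by (simp add: vec_eq_iff L_def matrix_axis_component)
  have "integrable M (\<lambda>t. \<Sum>j\<in>UNIV. L j ((indicator S t *\<^sub>R F t) *v axis j 1))"
    using assms unfolding set_integrable_def
    by (intro Bochner_Integration.integrable_sum integrable_bounded_linear[OF L])
       (simp add: scaleR_matrix_vector)
  then show ?thesis unfolding set_integrable_def by (subst F)
qed

text \<open>After summation by parts the damped sum is a convex combination of partial sums of
  \<open>b\<close>: the weights s^i - s^(i+1) and s^N are nonnegative and add up to 1.\<close>

lemma abel_partial_sum_bound:
  fixes b :: "nat \<Rightarrow> 'a::real_normed_vector"
  assumes B: "\<And>N. norm (\<Sum>i<N. b i) \<le> C" and s: "0 \<le> s" "s \<le> 1"
  shows "norm (\<Sum>i<N. s ^ i *\<^sub>R b i) \<le> C"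
proof -
  define S where "S N = (\<Sum>i<N. b i)" for N
  have parts: "(\<Sum>i<N. s ^ i *\<^sub>R b i) = (\<Sum>i<N. (s ^ i - s ^ Suc i) *\<^sub>R S (Suc i)) + s ^ N *\<^sub>R S N"
    by (induction N) (simp_all add: S_def algebra_simps)
  have dec: "s ^ i - s ^ Suc i \<ge> 0" for i
    using power_decreasing[of i "Suc i" s] s by simp
  have "norm (\<Sum>i<N. s ^ i *\<^sub>R b i) \<le> (\<Sum>i<N. norm ((s ^ i - s ^ Suc i) *\<^sub>R S (Suc i))) + norm (s ^ N *\<^sub>R S N)"
    unfolding parts by (intro norm_triangle_le add_mono norm_sum order_refl)
  also have "\<dots> \<le> (\<Sum>i<N. (s ^ i - s ^ Suc i) * C) + s ^ N * C"
    using dec s B by (intro add_mono sum_mono) (auto simp: S_def simp del: power_Suc sum.lessThan_Suc intro!: mult_left_mono)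
  also have "\<dots> = C"
    by (simp only: sum_distrib_right[symmetric] sum_lessThan_telescope') (simp add: algebra_simps)
  finally show ?thesis .
qed

text \<open>Abel's bound with s = t / z, applied to partial sums that are bounded because the series
  converges at z. Shifting by \<open>m\<close> only rescales the terms by z^m.\<close>

lemma power_series_tail_bound:
  fixes X :: "nat \<Rightarrow> 'a::banach"
  assumes z: "z > (0::real)" and X: "summable (\<lambda>n. z ^ n *\<^sub>R X n)"
  obtains C where "C \<ge> 0" "\<And>N t. 0 \<le> t \<Longrightarrow> t \<le> z \<Longrightarrow> norm (\<Sum>i<N. t ^ i *\<^sub>R X (i + m)) \<le> C"
proof -
  define b where "b i = z ^ i *\<^sub>R X (i + m)" for i
  have "summable (\<lambda>i. z ^ (i + m) *\<^sub>R X (i + m))"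
    using X by (subst summable_iff_shift)
  then have "summable (\<lambda>i. (1 / z ^ m) *\<^sub>R (z ^ (i + m) *\<^sub>R X (i + m)))"
    by (rule summable_scaleR_right)
  then have "summable b" using z by (simp add: b_def[abs_def] power_add)
  then have "Bseq (\<lambda>N. \<Sum>i<N. b i)"
    by (intro Cauchy_Bseq convergent_Cauchy) (simp add: summable_iff_convergent)
  then obtain C where C: "C > 0" "\<And>N. norm (\<Sum>i<N. b i) \<le> C" by (auto elim: BseqE)
  have "norm (\<Sum>i<N. t ^ i *\<^sub>R X (i + m)) \<le> C" if "0 \<le> t" "t \<le> z" for N t
  proof -
    have "norm (\<Sum>i<N. (t / z) ^ i *\<^sub>R b i) \<le> C"
      using that z by (intro abel_partial_sum_bound C) auto
    then show ?thesis using z by (simp add: b_def power_divide)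
  qed
  with C(1) show ?thesis by (intro that[of C]) auto
qed

lemma power_series_integral:
  fixes X :: "nat \<Rightarrow> complex^'n^'m" and w :: "nat \<Rightarrow> complex^'n" and K m :: nat
  assumes z: "z > 0" and mu: "Re \<mu> > 0" and a: "Re a > 0"
    and X: "\<And>t. 0 < t \<Longrightarrow> t \<le> z \<Longrightarrow> summable (\<lambda>n. t ^ n *\<^sub>R X n)"
  defines "u \<equiv> \<lambda>t. \<Sum>k<K. beta_kernel z \<mu> a k t *s w k"
    and "S \<equiv> \<lambda>t. \<Sum>i. t ^ i *\<^sub>R X (i + m)"
  shows "set_integrable lborel {0<..<z} (\<lambda>t. S t *v u t)"
    and "(\<lambda>i. X (i + m) *v (\<Sum>k<K. beta_moment z \<mu> (a + of_nat i) k *s w k)) sums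
           (LINT t:{0<..<z}|lborel. S t *v u t)"
proof -
  obtain C where C: "C \<ge> 0" "\<And>N t. 0 \<le> t \<Longrightarrow> t \<le> z \<Longrightarrow> norm (\<Sum>i<N. t ^ i *\<^sub>R X (i + m)) \<le> C"
    using power_series_tail_bound[OF z X[OF z order_refl]] by blast
  obtain B where B: "B > 0" "\<And>(A::complex^'n^'m) x. norm (A *v x) \<le> norm A * norm x * B"
    using bounded_bilinear.pos_bounded[OF bounded_bilinear_matrix_vector] by blast
  have scal_int: "set_integrable lborel {0<..<z} (\<lambda>t. beta_kernel z \<mu> b k t *s x)"
      "(LINT t:{0<..<z}|lborel. beta_kernel z \<mu> b k t *s x) = beta_moment z \<mu> b k *s x"
    if "Re b > 0" for b k and x :: "complex^'l"
    using integrable_bounded_linear[OF bounded_linear_vec_scalar, of lborel "\<lambda>t. indicator {0<..<z} t *\<^sub>R beta_kernel z \<mu> b k t" x]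
      integral_bounded_linear[OF bounded_linear_vec_scalar, of lborel "\<lambda>t. indicator {0<..<z} t *\<^sub>R beta_kernel z \<mu> b k t" x]
      set_integrable_beta_kernel[OF z mu that, of k]
    by (simp_all add: set_integrable_def set_lebesgue_integral_def beta_moment_def
          linear_scale[OF bounded_linear.linear[OF bounded_linear_vec_scalar]])
  have u_int: "set_integrable lborel {0<..<z} u"
    using scal_int(1)[OF a] unfolding u_def set_integrable_def scaleR_sum_right
    by (intro Bochner_Integration.integrable_sum)
  define s where "s N t = (\<Sum>i<N. t ^ i *\<^sub>R X (i + m)) *v u t" for N t
  have term_eq: "(t ^ i *\<^sub>R X (i + m)) *v u t = (\<Sum>k<K. beta_kernel z \<mu> (a + of_nat i) k t *s (X (i + m) *v w k))"
    if t: "t \<in> {0<..<z}" for i t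
  proof -
    \<comment> \<open>The power t^i is absorbed into the exponent, turning the i-th term into a
      moment at a + i.\<close>
    have "beta_kernel z \<mu> a k t * of_real t ^ i = beta_kernel z \<mu> (a + of_nat i) k t" for k
    proof -
      have "complex_of_real t powr (a + of_nat i - 1) = of_real t powr (a - 1) * of_real t ^ i"
        using t powr_add[of "complex_of_real t" "a - 1" "of_nat i"]
        by (simp add: powr_nat' algebra_simps)
      then show ?thesis by (simp add: beta_kernel_def)
    qed
    then show ?thesis
      unfolding u_def scaleR_matrix_vector matrix_vector_mult_sum_right vector_scalar_commute scaleR_sum_right
      by (simp flip: of_real_scale)
  qed
  have term_int: "integrable lborel (\<lambda>t. indicator {0<..<z} t *\<^sub>R ((t ^ i *\<^sub>R X (i + m)) *v u t))"
    and term_integral: "(LINT t:{0<..<z}|lborel. (t ^ i *\<^sub>R X (i + m)) *v u t) =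
        X (i + m) *v (\<Sum>k<K. beta_moment z \<mu> (a + of_nat i) k *s w k)" for i
  proof -
    have ai: "Re (a + of_nat i) > 0" using a by simp
    have eq: "indicator {0<..<z} t *\<^sub>R ((t ^ i *\<^sub>R X (i + m)) *v u t) =
        (\<Sum>k<K. indicator {0<..<z} t *\<^sub>R (beta_kernel z \<mu> (a + of_nat i) k t *s (X (i + m) *v w k)))" for t
      using term_eq[of t i] by (auto simp: indicator_def)
    have int: "integrable lborel (\<lambda>t. indicator {0<..<z} t *\<^sub>R (beta_kernel z \<mu> (a + of_nat i) k t *s (X (i + m) *v w k)))" for k
      using scal_int(1)[OF ai] by (simp add: set_integrable_def)
    show "integrable lborel (\<lambda>t. indicator {0<..<z} t *\<^sub>R ((t ^ i *\<^sub>R X (i + m)) *v u t))"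
      unfolding eq by (intro Bochner_Integration.integrable_sum int)
    have "(LINT t:{0<..<z}|lborel. (t ^ i *\<^sub>R X (i + m)) *v u t) =
        (\<Sum>k<K. LINT t:{0<..<z}|lborel. beta_kernel z \<mu> (a + of_nat i) k t *s (X (i + m) *v w k))"
      unfolding set_lebesgue_integral_def eq by (intro Bochner_Integration.integral_sum int)
    also have "\<dots> = X (i + m) *v (\<Sum>k<K. beta_moment z \<mu> (a + of_nat i) k *s w k)"
      by (simp add: scal_int(2)[OF ai] matrix_vector_mult_sum_right vector_scalar_commute)
    finally show "(LINT t:{0<..<z}|lborel. (t ^ i *\<^sub>R X (i + m)) *v u t) =
        X (i + m) *v (\<Sum>k<K. beta_moment z \<mu> (a + of_nat i) k *s w k)" .
  qed
  have s_eq: "indicator {0<..<z} t *\<^sub>R s N t = (\<Sum>i<N. indicator {0<..<z} t *\<^sub>R ((t ^ i *\<^sub>R X (i + m)) *v u t))" for N t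
    by (simp add: s_def matrix_vector_mult_sum_left scaleR_sum_right)
  have s_int: "integrable lborel (\<lambda>t. indicator {0<..<z} t *\<^sub>R s N t)" for N
    unfolding s_eq by (intro Bochner_Integration.integrable_sum term_int)
  have s_integral: "(\<integral>t. indicator {0<..<z} t *\<^sub>R s N t \<partial>lborel) =
      (\<Sum>i<N. X (i + m) *v (\<Sum>k<K. beta_moment z \<mu> (a + of_nat i) k *s w k))" for N
    unfolding s_eq Bochner_Integration.integral_sum[OF term_int] term_integral[symmetric] set_lebesgue_integral_def ..
  have lim: "(\<lambda>N. s N t) \<longlonglongrightarrow> S t *v u t" if t: "t \<in> {0<..<z}" for t
  proof -
    have "summable (\<lambda>i. t ^ (i + m) *\<^sub>R X (i + m))"
      using X[of t] t by (subst summable_iff_shift) auto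
    then have "summable (\<lambda>i. (1 / t ^ m) *\<^sub>R (t ^ (i + m) *\<^sub>R X (i + m)))"
      by (rule summable_scaleR_right)
    then have "summable (\<lambda>i. t ^ i *\<^sub>R X (i + m))" using t by (simp add: power_add)
    then have "(\<lambda>N. \<Sum>i<N. t ^ i *\<^sub>R X (i + m)) \<longlonglongrightarrow> S t"
      unfolding S_def by (rule summable_LIMSEQ)
    then show ?thesis
      unfolding s_def by (intro bounded_linear.tendsto[OF bounded_linear_matrix_vector_left])
  qed
  have bound: "norm (s N t) \<le> C * B * norm (u t)" if t: "t \<in> {0<..<z}" for N t
  proof -
    have "norm (s N t) \<le> norm (\<Sum>i<N. t ^ i *\<^sub>R X (i + m)) * norm (u t) * B"
      unfolding s_def by (rule B)
    also have "\<dots> \<le> C * norm (u t) * B"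
      using C(2)[of t N] B(1) t by (intro mult_right_mono) auto
    finally show ?thesis by (simp add: mult_ac)
  qed
  have dom: "integrable lborel (\<lambda>t. C * B * norm (indicator {0<..<z} t *\<^sub>R u t))"
    using u_int unfolding set_integrable_def
    by (intro integrable_mult_right integrable_norm)
  have lim': "AE t in lborel. (\<lambda>N. indicator {0<..<z} t *\<^sub>R s N t) \<longlonglongrightarrow> indicator {0<..<z} t *\<^sub>R (S t *v u t)"
    using lim by (intro AE_I2) (auto simp: indicator_def)
  have meas: "(\<lambda>t. indicator {0<..<z} t *\<^sub>R (S t *v u t)) \<in> borel_measurable lborel"
    by (rule borel_measurable_LIMSEQ_metric[of "\<lambda>N t. indicator {0<..<z} t *\<^sub>R s N t"])
       (use s_int lim in \<open>auto simp: indicator_def borel_measurable_integrable\<close>)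
  have bound': "AE t in lborel. norm (indicator {0<..<z} t *\<^sub>R s N t) \<le> C * B * norm (indicator {0<..<z} t *\<^sub>R u t)" for N
    using bound by (intro AE_I2) (auto simp: indicator_def)
  note dc = meas borel_measurable_integrable[OF s_int] dom lim' bound'
  show "set_integrable lborel {0<..<z} (\<lambda>t. S t *v u t)"
    unfolding set_integrable_def by (rule integrable_dominated_convergence[OF dc])
  show "(\<lambda>i. X (i + m) *v (\<Sum>k<K. beta_moment z \<mu> (a + of_nat i) k *s w k)) sums
      (LINT t:{0<..<z}|lborel. S t *v u t)"
    unfolding sums_def set_lebesgue_integral_def s_integral[symmetric]
    by (rule integral_dominated_convergence[OF dc])
qed

text \<open>If the integral had the value I, then \<open>e\<close> is chosen so that the integral of
  1/t over [e, d/2] alone equals |I| + 1.\<close>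

lemma not_set_integrable_inverse:
  assumes "d > (0::real)"
  shows "\<not> set_integrable lborel {0<..<d} (\<lambda>t. 1 / t)"
proof
  assume int: "set_integrable lborel {0<..<d} (\<lambda>t. 1 / t)"
  define I where "I = integral {0<..<d} (\<lambda>t. 1 / t)"
  define e where "e = d / 2 * exp (- \<bar>I\<bar> - 1)"
  have e: "0 < e" "e \<le> d / 2" using assms by (auto simp: e_def intro!: mult_left_le)
  have "((\<lambda>t. 1 / t) has_integral (ln (d / 2) - ln e)) {e..d / 2}"
    using e by (intro fundamental_theorem_of_calculus)
      (auto intro!: derivative_eq_intros simp flip: has_real_derivative_iff_has_vector_derivative)
  moreover have "ln (d / 2) - ln e = \<bar>I\<bar> + 1"
    unfolding e_def using assms by (subst ln_mult) auto
  ultimately have "\<bar>I\<bar> + 1 \<le> I"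
    using e assms set_borel_integral_eq_integral(1)[OF int] unfolding I_def
    by (intro has_integral_subset_le[of "{e..d/2}" "{0<..<d}" "\<lambda>t. 1 / t" _ "integral {0<..<d} (\<lambda>t. 1 / t)"])
       (auto simp: integrable_integral)
  then show False by linarith
qed

section \<open>Power series times a matrix power\<close>

text \<open>Abstracts the hypergeometric coefficients to arbitrary matrices \<open>X n\<close>, with
  no commutation with \<open>D\<close> assumed. The spectral condition is what admissibility says
  about \<open>D\<close>.\<close>

locale rl_power_series =
  fixes D :: "complex^'r^'r" and X :: "nat \<Rightarrow> complex^'r^'r" and \<mu> :: complex and z :: real
  assumes mu: "Re \<mu> > 0" and z: "z > 0"
    and spectrum: "eigenvalue_of D l \<Longrightarrow> l \<notin> \<int>\<^sub>\<le>\<^sub>0"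
    and conv: "0 < t \<Longrightarrow> t \<le> z \<Longrightarrow> summable (\<lambda>n. t ^ n *\<^sub>R X n)"
begin

definition "ser t = (\<Sum>n. t ^ n *\<^sub>R X n) ** mat_powr t (D - mat 1)"

text \<open>For Re (w + n) > 0 this is the fractional integral of order \<mu> of t^(w+n-1),
  evaluated at z. Elsewhere it is the analytic continuation, so \<open>moment n\<close> makes sense
  on the whole spectrum of \<open>D\<close>.\<close>

definition "moment_fun n w = of_real z powr (w + of_nat n + \<mu> - 1) * Gamma (w + of_nat n) * rGamma (w + of_nat n + \<mu>)"

definition "moment n = mat_fun (moment_fun n) D"

definition "tail m t = (\<Sum>i. t ^ i *\<^sub>R X (i + m))"

definition "weight t = complex_of_real (z - t) powr (\<mu> - 1)"

lemma RL_integrable_iff: "RL_integrable \<mu> ser z \<longleftrightarrow> set_integrable lborel {0<..<z} (\<lambda>t. mat (weight t) ** ser t)"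
  by (simp add: RL_integrable_def weight_def)

lemma integrand_vec: "(mat (weight t) ** ser t) *v v = weight t *s (ser t *v v)"
  by (simp add: mat_mult_vec flip: matrix_vector_mul_assoc)

lemma moment_fun_analytic: "moment_fun n analytic_on {l. eigenvalue_of D l}"
proof -
  have "l + of_nat n \<notin> \<int>\<^sub>\<le>\<^sub>0" if "eigenvalue_of D l" for l
    using spectrum[OF that] by (metis add_diff_cancel_right' nonpos_Ints_diff_Nats of_nat_in_Nats)
  then show ?thesis
    unfolding moment_fun_def[abs_def] using z by (intro analytic_intros) auto
qed

section \<open>Integrals over one generalized eigenspace\<close>

lemma mat_powr_gen_eigenvector:
  assumes t: "t > 0" and K: "shift_pow D l K v = 0"
  shows "mat_powr t (D - mat 1) *v v =
    (\<Sum>k<K. (of_real t powr (l - 1) * of_real (ln t) ^ k / fact k) *s shift_pow D l k v)"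
proof -
  define L where "L = complex_of_real (ln t)"
  have powr: "(\<lambda>w. of_real t powr (w + (- 1))) = (\<lambda>w. exp (L * w + (- L)))"
    using t by (auto simp: powr_def L_def Ln_of_real algebra_simps)
  have dexp: "(deriv ^^ k) exp = (exp :: complex \<Rightarrow> complex)" for k
    by (induction k) (auto intro!: DERIV_imp_deriv)
  have "(deriv ^^ k) (\<lambda>w. exp (L * w + (- L))) l = L ^ k * exp (L * l + (- L))" for k
    by (subst higher_deriv_compose_linear'[where S = UNIV and T = UNIV])
       (auto simp: dexp holomorphic_on_exp)
  moreover have "of_real t powr (l - 1) = exp (L * l + (- L))"
    using fun_cong[OF powr, of l] by simp
  ultimately have d: "(deriv ^^ k) (\<lambda>w. of_real t powr (w + (- 1))) l = of_real t powr (l - 1) * L ^ k" for k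
    unfolding powr by (simp only: mult.commute)
  have "D - mat 1 = D + mat (- 1)" by (simp add: mat_def vec_eq_iff)
  then have "mat_powr t (D - mat 1) = mat_fun (\<lambda>w. of_real t powr (w + (- 1))) D"
    by (simp only: mat_powr_eq_mat_fun[OF t] mat_fun_shift)
  moreover have "(\<lambda>w. of_real t powr (w + (- 1))) analytic_on {l. eigenvalue_of D l}"
    using t by (intro analytic_intros) auto
  ultimately show ?thesis
    by (simp only: mat_fun_gen_eigenvector[OF _ K] d L_def)
qed

lemma weight_gen_eigenvector:
  assumes t: "t \<in> {0<..<z}" and K: "shift_pow D l K v = 0"
  shows "weight t *s (t ^ m *\<^sub>R (mat_powr t (D - mat 1) *v v)) =
    (\<Sum>k<K. beta_kernel z \<mu> (l + of_nat m) k t *s ((1 / fact k) *s shift_pow D l k v))"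
proof -
  have "complex_of_real t powr (l + of_nat m - 1) = of_real t powr (l - 1) * of_real t ^ m"
    using t powr_add[of "complex_of_real t" "l - 1" "of_nat m"]
    by (simp add: powr_nat' algebra_simps)
  then show ?thesis
    using t by (simp add: mat_powr_gen_eigenvector[OF _ K] vec.scale_sum_right weight_def beta_kernel_def mult_ac
          flip: of_real_scale)
qed

lemma moment_gen_eigenvector:
  assumes l: "Re l + real n > 0" and K: "shift_pow D l K v = 0"
  shows "Gamma \<mu> *s (moment n *v v) =
    (\<Sum>k<K. beta_moment z \<mu> (l + of_nat n) k *s ((1 / fact k) *s shift_pow D l k v))"
proof -
  have "mat_fun (\<lambda>w. Gamma \<mu> * moment_fun n w) D = mat (Gamma \<mu>) ** moment n"
    using mat_fun_mult[of "\<lambda>_. Gamma \<mu>" D "moment_fun n"] moment_fun_analytic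
    by (simp add: mat_fun_const moment_def analytic_on_const)
  then have "Gamma \<mu> *s (moment n *v v) = mat_fun (\<lambda>w. Gamma \<mu> * moment_fun n w) D *v v"
    by (simp add: mat_mult_vec flip: matrix_vector_mul_assoc)
  also have "\<dots> = (\<Sum>k<K. ((deriv ^^ k) (\<lambda>w. Gamma \<mu> * moment_fun n w) l / fact k) *s shift_pow D l k v)"
    by (rule mat_fun_gen_eigenvector[OF _ K]) (intro analytic_intros moment_fun_analytic)
  also have "\<dots> = (\<Sum>k<K. beta_moment z \<mu> (l + of_nat n) k *s ((1 / fact k) *s shift_pow D l k v))"
    using l by (simp add: beta_moment_eq_higher_deriv[OF z mu] moment_fun_def)
  finally show ?thesis .
qed

text \<open>Moving t^m from the series into the matrix power raises the exponent from l to l + m,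
  which brings it into the half plane where the beta integral converges.\<close>

lemma tail_integral:
  assumes l: "Re l + real m > 0" and K: "shift_pow D l K v = 0"
  shows "set_integrable lborel {0<..<z} (\<lambda>t. weight t *s (tail m t *v (t ^ m *\<^sub>R (mat_powr t (D - mat 1) *v v))))"
    and "(\<lambda>i. Gamma \<mu> *s (X (i + m) *v (moment (i + m) *v v))) sums
      (LINT t:{0<..<z}|lborel. weight t *s (tail m t *v (t ^ m *\<^sub>R (mat_powr t (D - mat 1) *v v))))"
proof -
  let ?w = "\<lambda>k. (1 / fact k) *s shift_pow D l k v"
  let ?u = "\<lambda>t. \<Sum>k<K. beta_kernel z \<mu> (l + of_nat m) k t *s ?w k"
  have a: "Re (l + of_nat m) > 0" using l by simp
  have eq: "weight t *s (tail m t *v (t ^ m *\<^sub>R (mat_powr t (D - mat 1) *v v))) = tail m t *v ?u t"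
    if "t \<in> {0<..<z}" for t
    by (simp only: weight_gen_eigenvector[OF that K, symmetric] vector_scalar_commute)
  have "Gamma \<mu> *s (X (i + m) *v (moment (i + m) *v v)) =
      X (i + m) *v (\<Sum>k<K. beta_moment z \<mu> (l + of_nat m + of_nat i) k *s ?w k)" for i
  proof -
    have "Re l + real (i + m) > 0" using l by simp
    from moment_gen_eigenvector[OF this K] show ?thesis
      by (simp add: add_ac flip: vector_scalar_commute)
  qed
  then show "(\<lambda>i. Gamma \<mu> *s (X (i + m) *v (moment (i + m) *v v))) sums
      (LINT t:{0<..<z}|lborel. weight t *s (tail m t *v (t ^ m *\<^sub>R (mat_powr t (D - mat 1) *v v))))"
  proof (simp only:)
    have "(LINT t:{0<..<z}|lborel. weight t *s (tail m t *v (t ^ m *\<^sub>R (mat_powr t (D - mat 1) *v v)))) =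
        (LINT t:{0<..<z}|lborel. tail m t *v ?u t)"
      by (rule set_lebesgue_integral_cong) (use eq in auto)
    then show "(\<lambda>i. X (i + m) *v (\<Sum>k<K. beta_moment z \<mu> (l + of_nat m + of_nat i) k *s ?w k)) sums
      (LINT t:{0<..<z}|lborel. weight t *s (tail m t *v (t ^ m *\<^sub>R (mat_powr t (D - mat 1) *v v))))"
      using power_series_integral(2)[OF z mu a conv, where K = K and w = ?w and m = m]
      by (simp only: tail_def)
  qed
  show "set_integrable lborel {0<..<z} (\<lambda>t. weight t *s (tail m t *v (t ^ m *\<^sub>R (mat_powr t (D - mat 1) *v v))))"
  proof -
    have "set_integrable lborel {0<..<z} (\<lambda>t. weight t *s (tail m t *v (t ^ m *\<^sub>R (mat_powr t (D - mat 1) *v v)))) \<longleftrightarrow>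
        set_integrable lborel {0<..<z} (\<lambda>t. tail m t *v ?u t)"
      by (rule set_integrable_cong) (use eq in auto)
    then show ?thesis
      using power_series_integral(1)[OF z mu a conv, where K = K and w = ?w and m = m]
      by (simp only: tail_def)
  qed
qed

lemma summable_tail:
  assumes "0 < t" "t \<le> z"
  shows "summable (\<lambda>i. t ^ i *\<^sub>R X (i + m))"
proof -
  have "summable (\<lambda>i. t ^ (i + m) *\<^sub>R X (i + m))"
    using conv[OF assms] by (subst summable_iff_shift)
  then have "summable (\<lambda>i. (1 / t ^ m) *\<^sub>R (t ^ (i + m) *\<^sub>R X (i + m)))"
    by (rule summable_scaleR_right)
  then show ?thesis using assms by (simp add: power_add)
qed

lemma ser_split:
  assumes t: "0 < t" "t \<le> z" and y: "\<And>i. i < m \<Longrightarrow> X i *v (mat_powr t (D - mat 1) *v v) = 0"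
  shows "ser t *v v = tail m t *v (t ^ m *\<^sub>R (mat_powr t (D - mat 1) *v v))"
proof -
  let ?y = "mat_powr t (D - mat 1) *v v"
  have "(\<Sum>n. t ^ n *\<^sub>R X n) = (\<Sum>i. t ^ (i + m) *\<^sub>R X (i + m)) + (\<Sum>i<m. t ^ i *\<^sub>R X i)"
    by (rule suminf_split_initial_segment[OF conv[OF t]])
  also have "(\<Sum>i. t ^ (i + m) *\<^sub>R X (i + m)) = t ^ m *\<^sub>R tail m t"
    unfolding tail_def by (subst suminf_scaleR_right[OF summable_tail[OF t]]) (simp add: power_add mult.commute)
  finally have "ser t *v v = (t ^ m *\<^sub>R tail m t) *v ?y + (\<Sum>i<m. t ^ i *\<^sub>R (X i *v ?y))"
    by (simp add: ser_def matrix_vector_mult_add_rdistrib matrix_vector_mult_sum_left scaleR_matrix_vector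
          flip: matrix_vector_mul_assoc)
  then show ?thesis
    using y by (simp add: scaleR_matrix_vector linear_scale[OF matrix_vector_mul_linear])
qed

lemma RL_integrable_if_spectrum_pos:
  assumes "\<And>l. eigenvalue_of D l \<Longrightarrow> Re l > 0"
  shows "RL_integrable \<mu> ser z"
  unfolding RL_integrable_iff
proof (rule set_integrable_matrixI)
  fix v
  show "set_integrable lborel {0<..<z} (\<lambda>t. (mat (weight t) ** ser t) *v v)"
    unfolding integrand_vec
  proof (induction v rule: gen_eigenspaces_induct[where M = D])
    case (gen l v)
    show ?case
    proof (cases "v = 0")
      case False
      then have "Re l > 0" using gen gen_eigenspace_eigenvalue assms by blast
      moreover obtain K where K: "shift_pow D l K v = 0" using gen by (auto simp: gen_eigenspace_def)
      ultimately have "set_integrable lborel {0<..<z}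
          (\<lambda>t. weight t *s (tail 0 t *v (t ^ 0 *\<^sub>R (mat_powr t (D - mat 1) *v v))))"
        by (intro tail_integral) auto
      moreover have "ser t *v v = tail 0 t *v (t ^ 0 *\<^sub>R (mat_powr t (D - mat 1) *v v))" if "t \<in> {0<..<z}" for t
        using that by (intro ser_split) auto
      then have "set_integrable lborel {0<..<z} (\<lambda>t. weight t *s (ser t *v v)) \<longleftrightarrow> set_integrable lborel {0<..<z}
          (\<lambda>t. weight t *s (tail 0 t *v (t ^ 0 *\<^sub>R (mat_powr t (D - mat 1) *v v))))"
        by (intro set_integrable_cong) auto
      ultimately show ?thesis by simp
    qed (simp add: set_integrable_def)
  next
    case (scale_add c v w)
    have "integrable lborel (\<lambda>t. c *s (indicator {0<..<z} t *\<^sub>R (weight t *s (ser t *v v))) +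
        indicator {0<..<z} t *\<^sub>R (weight t *s (ser t *v w)))"
      using scale_add unfolding set_integrable_def
      by (intro Bochner_Integration.integrable_add integrable_bounded_linear[OF bounded_linear_scalar_vec])
    moreover have "indicator {0<..<z} t *\<^sub>R (weight t *s (ser t *v (c *s v + w))) =
        c *s (indicator {0<..<z} t *\<^sub>R (weight t *s (ser t *v v))) +
        indicator {0<..<z} t *\<^sub>R (weight t *s (ser t *v w))" for t
      by (simp add: indicator_def matrix_vector_right_distrib vector_scalar_commute vec.scale_right_distrib mult.commute)
    ultimately show ?case by (simp add: set_integrable_def)
  qed
qed

lemma ex_shift: "\<exists>m. Re l + real m > 0"
proof -
  obtain m where "- Re l < real m" using reals_Archimedean2 by blast
  then show ?thesis by (intro exI[of _ m]) linarith
qed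

lemma Gamma_mu_nonzero: "Gamma \<mu> \<noteq> 0"
  using mu by (auto simp: Gamma_eq_zero_iff elim!: nonpos_Ints_cases)

text \<open>Convergence does not depend on finitely many terms, so on each generalized eigenspace
  the series may start at an index m with Re l + m > 0.\<close>

lemma summable_series: "summable (\<lambda>n. X n ** moment n)"
proof (rule summable_matrixI)
  fix v
  show "summable (\<lambda>n. (X n ** moment n) *v v)"
    unfolding matrix_vector_mul_assoc[symmetric]
  proof (induction v rule: gen_eigenspaces_induct[where M = D])
    case (gen l v)
    obtain K where K: "shift_pow D l K v = 0" using gen by (auto simp: gen_eigenspace_def)
    obtain m where m: "Re l + real m > 0" using ex_shift by blast
    have "summable (\<lambda>i. Gamma \<mu> *s (X (i + m) *v (moment (i + m) *v v)))"
      using tail_integral(2)[OF m K] by (rule sums_summable)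
    then have "summable (\<lambda>i. (1 / Gamma \<mu>) *s (Gamma \<mu> *s (X (i + m) *v (moment (i + m) *v v))))"
      by (rule bounded_linear.summable[OF bounded_linear_scalar_vec])
    then have "summable (\<lambda>i. X (i + m) *v (moment (i + m) *v v))"
      using Gamma_mu_nonzero by simp
    then show ?case by (subst (asm) summable_iff_shift[where f = "\<lambda>i. X i *v (moment i *v v)"])
  next
    case (scale_add c v w)
    then show ?case
      by (simp add: matrix_vector_right_distrib vector_scalar_commute)
         (intro summable_add bounded_linear.summable[OF bounded_linear_scalar_vec])
  qed
qed

lemma norm_scalar_vec: "norm (c *s (v::complex^'m)) = cmod c * norm v"
  by (simp add: norm_vec_def L2_set_def norm_mult power_mult_distrib real_sqrt_mult
        flip: sum_distrib_left)

text \<open>If the lowest coefficient \<open>X n\<close> with \<open>n + Re l \<le> 0\<close> did not kill the generalized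
  eigenspace of \<open>l\<close>, the integrand would dominate a multiple of \<open>1/t\<close> near \<open>0\<close>.\<close>
lemma coefficient_vanishes:
  assumes int: "RL_integrable \<mu> ser z"
  shows "v \<in> gen_eigenspace D l \<Longrightarrow> Re l + real n \<le> 0 \<Longrightarrow> X n *v v = 0"
proof (induction n arbitrary: v rule: less_induct)
  case (less n)
  show ?case
  proof (rule ccontr)
    assume v: "X n *v v \<noteq> 0"
    obtain K where K: "shift_pow D l K v = 0" using less.prems by (auto simp: gen_eigenspace_def)
    \<comment> \<open>Passing to the last vector \<open>u\<close> of the chain not killed by
      \<open>X n\<close> removes all logarithms: \<open>X n\<close> annihilates every further shift
      of \<open>u\<close>, and the n-th term reduces to a pure power of t times a nonzero
      vector.\<close>
    define A where "A = {k. X n *v shift_pow D l k v \<noteq> 0}"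
    have "A \<subseteq> {..<K}"
    proof
      fix k assume "k \<in> A"
      then show "k \<in> {..<K}" using shift_pow_eq_0_mono[OF K, of k] by (cases "k < K") (auto simp: A_def)
    qed
    then have A: "finite A" by (rule finite_subset) simp
    have "A \<noteq> {}" using v by (auto simp: A_def intro!: exI[of _ 0])
    define u where "u = shift_pow D l (Max A) v"
    have u_nz: "X n *v u \<noteq> 0" using Max_in[OF A \<open>A \<noteq> {}\<close>] by (simp add: A_def u_def)
    have u_up: "X n *v shift_pow D l k u = 0" if "k > 0" for k
    proof (rule ccontr)
      assume "X n *v shift_pow D l k u \<noteq> 0"
      then have "k + Max A \<in> A" by (simp add: A_def u_def shift_pow_add)
      then show False using Max_ge[OF A] that by fastforce
    qed
    have u_gen: "shift_pow D l k u \<in> gen_eigenspace D l" for k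
      using less.prems by (simp add: u_def gen_eigenspace_shift_pow)
    have Ku: "shift_pow D l K u = 0"
      using shift_pow_eq_0_mono[OF K, of "K + Max A"] by (simp add: u_def shift_pow_add)
    have u_low: "X i *v shift_pow D l k u = 0" if "i < n" for i k
      using that less.prems by (intro less.IH u_gen) auto
    define y where "y t = mat_powr t (D - mat 1) *v u" for t
    have y: "y t = (\<Sum>k<K. (of_real t powr (l - 1) * of_real (ln t) ^ k / fact k) *s shift_pow D l k u)"
      if "t > 0" for t
      unfolding y_def by (rule mat_powr_gen_eigenvector[OF that Ku])
    have y_low: "X i *v y t = 0" if "i < n" "t > 0" for i t
      using that by (simp add: y matrix_vector_mult_sum_right vector_scalar_commute u_low)
    have y_n: "X n *v y t = of_real t powr (l - 1) *s (X n *v u)" if t: "t > 0" for t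
    proof -
      have "K > 0" using Ku u_nz by (cases K) auto
      then have "X n *v y t = (\<Sum>k\<in>{0}. (of_real t powr (l - 1) * of_real (ln t) ^ k / fact k) *s (X n *v shift_pow D l k u))"
        unfolding y[OF t] matrix_vector_mult_sum_right vector_scalar_commute
        by (intro sum.mono_neutral_right) (auto simp: u_up)
      then show ?thesis by simp
    qed
    obtain C where C: "C \<ge> 0" "\<And>N t. 0 \<le> t \<Longrightarrow> t \<le> z \<Longrightarrow> norm (\<Sum>i<N. t ^ i *\<^sub>R X (i + Suc n)) \<le> C"
      using power_series_tail_bound[OF z conv[OF z order_refl]] by blast
    have tail_bound: "norm (tail (Suc n) t) \<le> C" if "0 < t" "t \<le> z" for t
      unfolding tail_def
      by (rule LIMSEQ_le_const2[OF tendsto_norm[OF summable_LIMSEQ[OF summable_tail[OF that]]]])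
         (use C(2) that in auto)
    obtain B where B: "B > 0" "\<And>(M::complex^'r^'r) x. norm (M *v x) \<le> norm M * norm x * B"
      using bounded_bilinear.pos_bounded[OF bounded_bilinear_matrix_vector] by blast
    define Q where "Q = (\<Sum>k<K. 2 ^ k * norm (shift_pow D l k u))"
    have Q: "Q \<ge> 0" by (auto simp: Q_def intro!: sum_nonneg)
    \<comment> \<open>The logarithms in \<open>y\<close> cost a factor t^(-1/2). The extra t in
      front of the tail leaves sqrt t, so the tail is of lower order than the n-th term.\<close>
    have norm_y: "norm (y t) \<le> t powr (Re l - 1) * (2 * Q * t powr (- 1/2))" if t: "0 < t" "t < 1" for t
    proof -
      have "norm (y t) \<le> (\<Sum>k<K. norm ((of_real t powr (l - 1) * of_real (ln t) ^ k / fact k) *s shift_pow D l k u))"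
        unfolding y[OF t(1)] by (rule norm_sum)
      also have "\<dots> \<le> (\<Sum>k<K. t powr (Re l - 1) * (2 ^ k * norm (shift_pow D l k u)) * (2 * t powr (- 1/2)))"
      proof (rule sum_mono)
        fix k
        have "\<bar>ln t\<bar> ^ k \<le> fact k / (1/2) ^ k * (t powr (1/2) + t powr (- (1/2)))"
          using t by (intro abs_ln_power_le) auto
        also have "t powr (1/2) \<le> t powr (- (1/2))"
          using t by (intro powr_mono') auto
        finally have "\<bar>ln t\<bar> ^ k / fact k \<le> 2 ^ k * (2 * t powr (- 1/2))"
          by (simp add: field_simps power_divide)
        then have "t powr (Re l - 1) * norm (shift_pow D l k u) * (\<bar>ln t\<bar> ^ k / fact k) \<le>
            t powr (Re l - 1) * norm (shift_pow D l k u) * (2 ^ k * (2 * t powr (- 1/2)))"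
          by (intro mult_left_mono) auto
        then show "norm ((of_real t powr (l - 1) * of_real (ln t) ^ k / fact k) *s shift_pow D l k u) \<le>
            t powr (Re l - 1) * (2 ^ k * norm (shift_pow D l k u)) * (2 * t powr (- 1/2))"
          using t by (simp add: norm_scalar_vec norm_mult norm_divide norm_power norm_powr_real_powr mult_ac)
      qed
      also have "\<dots> = t powr (Re l - 1) * (2 * Q * t powr (- 1/2))"
        by (simp add: Q_def sum_distrib_left sum_distrib_right mult_ac)
      finally show ?thesis .
    qed
    define c where "c = norm (X n *v u)"
    have c: "c > 0" using u_nz by (simp add: c_def)
    define E where "E = C * B * (2 * Q)"
    have E: "E \<ge> 0" using C B Q by (simp add: E_def)
    \<comment> \<open>The bound 1 serves the estimate of the logarithms, z / 2 the estimate of the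
      weight, and the square gives E sqrt t <= c / 2. Using E + 1 avoids division by zero.\<close>
    define d where "d = Min {1, z / 2, (c / (2 * (E + 1)))\<^sup>2}"
    have d: "d > 0" "d \<le> 1" "d \<le> z / 2" "d \<le> (c / (2 * (E + 1)))\<^sup>2"
      using z c E by (auto simp: d_def)
    \<comment> \<open>A lower bound of the weight on (0, z/2]: it is monotone in t, in a direction
      that depends on the sign of Re \<mu> - 1, so the smaller endpoint value is taken.\<close>
    define \<kappa> where "\<kappa> = min (z powr (Re \<mu> - 1)) ((z / 2) powr (Re \<mu> - 1))"
    have \<kappa>: "\<kappa> > 0" using z by (simp add: \<kappa>_def)
    have lower: "norm (\<kappa> * (c / 2) * (1 / t)) \<le> norm (weight t *s (ser t *v u))" if t: "t \<in> {0<..<d}" for t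
    proof -
      have t': "0 < t" "t < 1" "t \<le> z" "t \<le> z / 2" using t d by auto
      have "tail n t = X n + t *\<^sub>R tail (Suc n) t"
      proof -
        have "tail n t = (\<Sum>i. t ^ (i + 1) *\<^sub>R X (i + 1 + n)) + X n"
          unfolding tail_def using suminf_split_initial_segment[OF summable_tail[OF t'(1,3)], of n 1] by simp
        also have "(\<Sum>i. t ^ (i + 1) *\<^sub>R X (i + 1 + n)) = t *\<^sub>R tail (Suc n) t"
          unfolding tail_def by (subst suminf_scaleR_right[OF summable_tail[OF t'(1,3)]]) simp
        finally show ?thesis by simp
      qed
      then have fu: "ser t *v u = t ^ n *\<^sub>R (of_real t powr (l - 1) *s (X n *v u) + t *\<^sub>R (tail (Suc n) t *v y t))"
        using ser_split[of t n u] t' y_low y_n[of t]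
        by (simp add: y_def[symmetric] linear_scale[OF matrix_vector_mul_linear]
              matrix_vector_mult_add_rdistrib scaleR_matrix_vector)
      have "norm (tail (Suc n) t *v y t) \<le> norm (tail (Suc n) t) * norm (y t) * B" by (rule B)
      also have "\<dots> \<le> C * (t powr (Re l - 1) * (2 * Q * t powr (- 1/2))) * B"
        using tail_bound[of t] norm_y[of t] t' B C Q by (intro mult_mono) auto
      finally have "t * norm (tail (Suc n) t *v y t) \<le> t * (C * (t powr (Re l - 1) * (2 * Q * t powr (- 1/2))) * B)"
        using t' by (intro mult_left_mono) auto
      also have "\<dots> = t powr (Re l - 1) * (E * (t * t powr (- 1/2)))"
        by (simp add: E_def mult_ac)
      also have "t * t powr (- 1/2) = sqrt t"
        using t' powr_add[of t 1 "- 1/2"] by (simp add: powr_half_sqrt)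
      also have "E * sqrt t \<le> c / 2"
      proof -
        have "sqrt t \<le> c / (2 * (E + 1))"
          using t d(4) c E by (intro real_le_lsqrt) auto
        then have "E * sqrt t \<le> E * (c / (2 * (E + 1)))"
          using E by (intro mult_left_mono) auto
        also have "\<dots> \<le> c / 2" using E c by (simp add: field_simps)
        finally show ?thesis .
      qed
      finally have small: "t * norm (tail (Suc n) t *v y t) \<le> t powr (Re l - 1) * (c / 2)"
        by (simp add: mult_left_mono)
      have "norm (of_real t powr (l - 1) *s (X n *v u)) = t powr (Re l - 1) * c"
        using t' by (simp add: norm_scalar_vec norm_powr_real_powr c_def)
      then have "t powr (Re l - 1) * (c / 2) \<le>
          norm (of_real t powr (l - 1) *s (X n *v u) + t *\<^sub>R (tail (Suc n) t *v y t))"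
        using small norm_triangle_ineq2[of "of_real t powr (l - 1) *s (X n *v u)" "- (t *\<^sub>R (tail (Suc n) t *v y t))"] t'
        by simp
      then have "t ^ n * (t powr (Re l - 1) * (c / 2)) \<le> norm (ser t *v u)"
        using t' by (simp add: fu mult_left_mono)
      \<comment> \<open>The exponent n + Re l - 1 is at most -1, and t < 1.\<close>
      moreover have "1 / t \<le> t ^ n * t powr (Re l - 1)"
      proof -
        have "t powr (- 1) \<le> t powr (real n + (Re l - 1))"
          using t' less.prems(2) by (intro powr_mono') auto
        then show ?thesis using t' by (simp add: powr_add powr_realpow powr_minus_divide)
      qed
      ultimately have "1 / t * (c / 2) \<le> norm (ser t *v u)"
        using c mult_right_mono[of "1 / t" "t ^ n * t powr (Re l - 1)" "c / 2"] by (simp add: mult.assoc)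
      moreover have "\<kappa> \<le> norm (weight t)"
      proof -
        have "norm (weight t) = (z - t) powr (Re \<mu> - 1)"
          using t' by (simp add: weight_def norm_powr_real_powr flip: of_real_diff)
        moreover have "\<kappa> \<le> (z - t) powr (Re \<mu> - 1)"
        proof (cases "Re \<mu> \<ge> 1")
          case True
          then have "(z / 2) powr (Re \<mu> - 1) \<le> (z - t) powr (Re \<mu> - 1)"
            using t' z by (intro powr_mono2) auto
          then show ?thesis by (simp add: \<kappa>_def)
        next
          case False
          then have "z powr (Re \<mu> - 1) \<le> (z - t) powr (Re \<mu> - 1)"
            using t' z by (intro powr_mono2') auto
          then show ?thesis by (simp add: \<kappa>_def)
        qed
        ultimately show ?thesis by simp
      qed
      ultimately have "\<kappa> * (1 / t * (c / 2)) \<le> norm (weight t) * norm (ser t *v u)"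
        using \<kappa> c t' by (intro mult_mono) auto
      then show ?thesis
        using \<kappa> c t' by (simp add: norm_scalar_vec mult_ac)
    qed
    have "set_integrable lborel {0<..<z} (\<lambda>t. weight t *s (ser t *v u))"
      using set_integrable_matrix_vector(1)[OF int[unfolded RL_integrable_iff], of u]
      by (simp add: integrand_vec)
    then have "set_integrable lborel {0<..<d} (\<lambda>t. weight t *s (ser t *v u))"
      by (rule set_integrable_subset) (use d z in auto)
    then have "set_integrable lborel {0<..<d} (\<lambda>t. \<kappa> * (c / 2) * (1 / t))"
      by (rule set_integrable_bound) (use lower in \<open>auto simp: set_borel_measurable_def\<close>)
    then have "set_integrable lborel {0<..<d} (\<lambda>t. 1 / t)"
      using \<kappa> c by (subst (asm) set_integrable_mult_right_iff) auto
    then show False using not_set_integrable_inverse[OF d(1)] by blast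
  qed
qed

text \<open>On a generalized eigenvector for l, the terms with Re l + n <= 0 vanish in the integrand
  as well as in the moment series, and the remaining tail is integrated term by term.\<close>

lemma RL_integral_eq:
  assumes int: "RL_integrable \<mu> ser z"
  shows "RL_integral \<mu> ser z = (\<Sum>n. X n ** moment n)"
proof (rule matrix_eqI_gen_eigenvectors[of D])
  fix l K v assume K: "shift_pow D l K v = 0"
  \<comment> \<open>Minimality gives Re l + i <= 0 for every i < m, the premise under which
    \<open>coefficient_vanishes\<close> kills the i-th coefficient.\<close>
  define m where "m = (LEAST m. Re l + real m > 0)"
  have m: "Re l + real m > 0"
    unfolding m_def using ex_shift by (rule LeastI_ex)
  have low: "X i *v shift_pow D l k v = 0" if "i < m" for i k
  proof (rule coefficient_vanishes[OF int])
    have "v \<in> gen_eigenspace D l" using K by (auto simp: gen_eigenspace_def)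
    then show "shift_pow D l k v \<in> gen_eigenspace D l" by (simp add: gen_eigenspace_shift_pow)
    show "Re l + real i \<le> 0" using not_less_Least[OF that[unfolded m_def]] by simp
  qed
  have "X i *v (mat_powr t (D - mat 1) *v v) = 0" if "i < m" "t > 0" for i t
    using that by (simp add: mat_powr_gen_eigenvector[OF _ K] matrix_vector_mult_sum_right vector_scalar_commute low)
  then have ser: "ser t *v v = tail m t *v (t ^ m *\<^sub>R (mat_powr t (D - mat 1) *v v))" if "t \<in> {0<..<z}" for t
    using that by (intro ser_split) auto
  have "(LINT t:{0<..<z}|lborel. mat (weight t) ** ser t) *v v =
      (LINT t:{0<..<z}|lborel. weight t *s (tail m t *v (t ^ m *\<^sub>R (mat_powr t (D - mat 1) *v v))))"
    unfolding set_integrable_matrix_vector(2)[OF int[unfolded RL_integrable_iff], symmetric] integrand_vec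
    by (rule set_lebesgue_integral_cong) (use ser in auto)
  moreover have "RL_integral \<mu> ser z *v v = (1 / Gamma \<mu>) *s ((LINT t:{0<..<z}|lborel. mat (weight t) ** ser t) *v v)"
    by (simp add: RL_integral_def weight_def mat_mult_vec flip: matrix_vector_mul_assoc)
  ultimately have "(\<lambda>i. (1 / Gamma \<mu>) *s (Gamma \<mu> *s (X (i + m) *v (moment (i + m) *v v)))) sums (RL_integral \<mu> ser z *v v)"
    using bounded_linear.sums[OF bounded_linear_scalar_vec[of "1 / Gamma \<mu>"] tail_integral(2)[OF m K]] by simp
  then have "(\<lambda>i. X (i + m) *v (moment (i + m) *v v)) sums (RL_integral \<mu> ser z *v v)"
    using Gamma_mu_nonzero by simp
  then have "(\<lambda>i. X i *v (moment i *v v)) sums (RL_integral \<mu> ser z *v v + (\<Sum>i<m. X i *v (moment i *v v)))"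
    by (subst (asm) sums_iff_shift[where f = "\<lambda>i. X i *v (moment i *v v)"])
  \<comment> \<open>\<open>moment i\<close> maps v to a combination of vectors of its chain, all of
    them killed by \<open>X i\<close>.\<close>
  moreover have "X i *v (moment i *v v) = 0" if "i < m" for i
    using that by (simp add: moment_def mat_fun_gen_eigenvector[OF moment_fun_analytic K] matrix_vector_mult_sum_right
          vector_scalar_commute low)
  ultimately have "(\<lambda>i. (X i ** moment i) *v v) sums (RL_integral \<mu> ser z *v v)"
    by (simp add: matrix_vector_mul_assoc)
  moreover have "(\<lambda>i. (X i ** moment i) *v v) sums ((\<Sum>n. X n ** moment n) *v v)"
    by (intro bounded_linear.sums[OF bounded_linear_matrix_vector_left] summable_sums summable_series)
  ultimately show "RL_integral \<mu> ser z *v v = (\<Sum>n. X n ** moment n) *v v" by (rule sums_unique2)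
qed

end

section \<open>Shifting a denominator parameter\<close>

lemma matrix_add_rdistrib: "((A :: 'a::semiring_1^'n^'m) + B) ** C = A ** C + B ** C"
  by (simp add: matrix_eq matrix_vector_mult_add_rdistrib flip: matrix_vector_mul_assoc)

lemma matrix_inv_commute:
  fixes M N :: "'a::semiring_1^'n^'n"
  assumes "invertible M" "N ** M = M ** N"
  shows "N ** matrix_inv M = matrix_inv M ** N"
proof -
  have "N ** matrix_inv M = matrix_inv M ** (M ** N) ** matrix_inv M"
    using matrix_inv_left[OF assms(1)] by (simp add: matrix_mul_assoc)
  also have "\<dots> = matrix_inv M ** N ** (M ** matrix_inv M)"
    by (simp only: assms(2)[symmetric] matrix_mul_assoc)
  finally show ?thesis using matrix_inv_right[OF assms(1)] by simp
qed

lemma mat_pochhammer_commute: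
  assumes "N ** M = M ** N"
  shows "N ** mat_pochhammer M n = mat_pochhammer M n ** N"
proof (induction n)
  case (Suc n)
  have "N ** (M + mat c) = (M + mat c) ** N" for c
    by (simp add: matrix_add_ldistrib matrix_add_rdistrib assms mat_mult_commute)
  with Suc show ?case by (simp add: matrix_mul_assoc) (metis matrix_mul_assoc)
qed simp

lemma invertible_mat_pochhammer:
  "(\<And>k. invertible (M + mat (of_nat k))) \<Longrightarrow> invertible (mat_pochhammer M n)"
  by (induction n) (auto simp: invertible_mult intro: invertible_mult exI[of _ "mat 1"] simp: invertible_def[of "mat 1"])

lemma analytic_pochhammer [analytic_intros]:
  "f analytic_on S \<Longrightarrow> (\<lambda>w. pochhammer (f w) n :: complex) analytic_on S"
  by (induction n) (auto simp: pochhammer_Suc intro!: analytic_intros)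

lemma mat_pochhammer_eq_mat_fun:
  "mat_pochhammer (D + mat c) n = mat_fun (\<lambda>w. pochhammer (w + c) n) D"
proof (induction n)
  case (Suc n)
  have "mat_fun (\<lambda>w. pochhammer (w + c) (Suc n)) D = mat_fun (\<lambda>w. pochhammer (w + c) n * (w + (c + of_nat n))) D"
    by (simp add: pochhammer_Suc add.assoc)
  also have "\<dots> = mat_pochhammer (D + mat c) n ** (D + mat (c + of_nat n))"
    by (subst mat_fun_mult) (auto intro!: analytic_intros simp: Suc mat_fun_linear)
  finally show ?case by (simp add: add.assoc mat_add_mat)
qed (simp add: mat_fun_const)

lemma mat_prod_list_append: "mat_prod_list (xs @ ys) = mat_prod_list xs ** mat_prod_list ys"
  by (induction xs) (simp_all add: mat_prod_list_def matrix_mul_assoc)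

lemma mat_prod_list_commute:
  assumes "\<And>M. M \<in> set Ms \<Longrightarrow> N ** M = M ** N"
  shows "N ** mat_prod_list Ms = mat_prod_list Ms ** N"
  using assms
proof (induction Ms)
  case (Cons M Ms)
  then have "N ** M = M ** N" "N ** mat_prod_list Ms = mat_prod_list Ms ** N" by auto
  then show ?case
    by (simp add: mat_prod_list_def matrix_mul_assoc) (metis matrix_mul_assoc)
qed (simp add: mat_prod_list_def)

text \<open>The Pochhammer symbol enters from the right and meets its inverse after passing the
  factors in \<open>ys\<close>, so commutation with these is what is required.\<close>

lemma cancel_pochhammer_factor:
  fixes E :: "complex^'r^'r" and n :: nat
  assumes adm: "pRq_admissible (xs @ E # ys)"
    and comm: "\<And>M. M \<in> set ys \<Longrightarrow> M ** E = E ** M"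
  defines "P \<equiv> \<lambda>Ms. mat_prod_list (map (\<lambda>M. matrix_inv (mat_pochhammer M n)) Ms)"
  shows "P (xs @ E # ys) ** mat_pochhammer E n = P xs ** P ys"
proof -
  have inv: "invertible (mat_pochhammer M n)" if "M \<in> set (xs @ E # ys)" for M
    using adm that by (intro invertible_mat_pochhammer) (auto simp: pRq_admissible_def)
  have "mat_pochhammer E n ** matrix_inv (mat_pochhammer M n) = matrix_inv (mat_pochhammer M n) ** mat_pochhammer E n"
    if "M \<in> set ys" for M
    using that comm[OF that]
    by (intro matrix_inv_commute inv mat_pochhammer_commute mat_pochhammer_commute[symmetric]) auto
  then have c: "mat_pochhammer E n ** P ys = P ys ** mat_pochhammer E n"
    unfolding P_def by (intro mat_prod_list_commute) auto
  have "P (xs @ E # ys) ** mat_pochhammer E n =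
      P xs ** (matrix_inv (mat_pochhammer E n) ** (P ys ** mat_pochhammer E n))"
    by (simp add: P_def mat_prod_list_append matrix_mul_assoc) (simp add: mat_prod_list_def matrix_mul_assoc)
  also have "\<dots> = P xs ** (matrix_inv (mat_pochhammer E n) ** mat_pochhammer E n) ** P ys"
    by (simp only: c[symmetric] matrix_mul_assoc)
  finally show ?thesis by (simp add: matrix_inv_left inv)
qed

lemma mat_mult_of_real: "M ** mat (of_real r) = r *\<^sub>R (M :: complex^'n^'n)"
  by (simp add: matrix_eq mat_mult_vec vector_scalar_commute of_real_scale scaleR_matrix_vector
        linear_scale[OF matrix_vector_mul_linear] flip: matrix_vector_mul_assoc)

section \<open>The hypergeometric series and its fractional integral\<close>

definition pRq_coeff ::
  "(complex^'r^'r) list \<Rightarrow> (complex^'r^'r) list \<Rightarrow> complex^'r^'r \<Rightarrow> complex^'r^'r \<Rightarrow> nat \<Rightarrow> complex^'r^'r" where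
  "pRq_coeff Cs Ds A B n =
     mat_rGamma (real n *\<^sub>R A + B)
     ** mat_prod_list (map (\<lambda>C. mat_pochhammer C n) Cs)
     ** mat_prod_list (map (\<lambda>D. matrix_inv (mat_pochhammer D n)) Ds)
     ** mat (1 / fact n)"

lemma pRq_term_eq: "pRq_term Cs Ds A B (of_real t) n = t ^ n *\<^sub>R pRq_coeff Cs Ds A B n"
proof -
  have *: "mat (of_real t ^ n / fact n) = (mat (1 / fact n) ** mat (of_real (t ^ n)) :: complex^'r^'r)"
    by (simp add: mat_mult_mat)
  show ?thesis
    unfolding pRq_term_def pRq_coeff_def * matrix_mul_assoc mat_mult_of_real
    by (simp add: matrix_scalar_ac scalar_matrix_assoc)
qed

text \<open>An eigenvalue of nonpositive real part can make the integral diverge. Integrability is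
  therefore asserted for spectrum in the open right half plane, while the identity is stated
  whenever the integral exists. Convergence of the series on the right is a conclusion.\<close>

theorem theorem6p2:
  fixes A B :: "complex^'r^'r"
    and Cs Ds :: "(complex^'r^'r) list"
    and \<mu> :: complex and j :: nat and z :: real
  assumes mu: "0 < Re \<mu>"
    and z: "0 < z"
    and j: "j < length Ds"
    and comm: "\<And>D D'. D \<in> set Ds \<Longrightarrow> D' \<in> set Ds \<Longrightarrow> D ** D' = D' ** D"
    and adm: "pRq_admissible Ds"
    and adm_shift: "pRq_admissible (Ds[j := Ds ! j + mat \<mu>])"
    and conv: "\<And>t::real. 0 < t \<Longrightarrow> t \<le> z \<Longrightarrow> summable (pRq_term Cs Ds A B (of_real t))"
  shows
    "let f = (\<lambda>t::real. pRq Cs Ds A B (of_real t) ** mat_powr t (Ds ! j - mat 1));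
         Ds' = Ds[j := Ds ! j + mat \<mu>]
     in ((\<forall>l. eigenvalue_of (Ds ! j) l \<longrightarrow> 0 < Re l) \<longrightarrow> RL_integrable \<mu> f z)
      \<and> summable (pRq_term Cs Ds' A B (of_real z))
      \<and> (RL_integrable \<mu> f z \<longrightarrow>
           RL_integral \<mu> f z =
             pRq Cs Ds' A B (of_real z)
             ** mat_powr z (Ds ! j + mat (\<mu> - 1))
             ** mat_Gamma (Ds ! j)
             ** mat_rGamma (Ds ! j + mat \<mu>))"
proof -
  define D where "D = Ds ! j"
  define Ds' where "Ds' = Ds[j := D + mat \<mu>]"
  have D_in: "D \<in> set Ds" and D'_in: "D + mat \<mu> \<in> set Ds'"
    using j by (auto simp: D_def Ds'_def set_update_memI)
  have D_spec: "l \<notin> \<int>\<^sub>\<le>\<^sub>0" if "eigenvalue_of D l" for l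
  proof
    assume "l \<in> \<int>\<^sub>\<le>\<^sub>0"
    then obtain k where "l = - of_nat k" by (auto elim: nonpos_Ints_cases')
    then show False
      using that adm D_in by (auto simp: pRq_admissible_def invertible_iff_not_eigenvalue)
  qed
  have D'_spec: "l + \<mu> \<notin> \<int>\<^sub>\<le>\<^sub>0" if "eigenvalue_of D l" for l
  proof
    assume "l + \<mu> \<in> \<int>\<^sub>\<le>\<^sub>0"
    then obtain k where "l + \<mu> = - of_nat k" by (auto elim: nonpos_Ints_cases')
    then have "eigenvalue_of (D + mat \<mu>) (- of_nat k)"
      using that by (metis add_diff_cancel_right' eigenvalue_of_add)
    then show False
      using adm_shift D'_in by (auto simp: pRq_admissible_def invertible_iff_not_eigenvalue Ds'_def D_def)
  qed
  define X where "X = pRq_coeff Cs Ds A B"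
  interpret rl_power_series D X \<mu> z
    by unfold_locales (use mu z D_spec conv in \<open>simp_all add: X_def pRq_term_eq[abs_def]\<close>)
  have ser_eq: "ser = (\<lambda>t. pRq Cs Ds A B (of_real t) ** mat_powr t (D - mat 1))"
    by (simp add: fun_eq_iff ser_def pRq_def pRq_term_eq flip: X_def)
  define W where "W = mat_powr z (D + mat (\<mu> - 1)) ** mat_Gamma D ** mat_rGamma (D + mat \<mu>)"
  \<comment> \<open>Absorbing all shifts into the argument turns the three factors of
    \<open>W\<close> into functions of the single matrix \<open>D\<close>.\<close>
  define W_fun where "W_fun w = of_real z powr (w + (\<mu> - 1)) * Gamma w * rGamma (w + \<mu>)" for w
  have W_analytic: "W_fun analytic_on {l. eigenvalue_of D l}"
    unfolding W_fun_def[abs_def] using z D_spec by (intro analytic_intros) auto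
  have W: "W = mat_fun W_fun D"
    unfolding W_def W_fun_def[abs_def] mat_powr_eq_mat_fun[OF z] mat_Gamma_def mat_rGamma_def mat_fun_shift
    using z D_spec by (subst mat_fun_mult mat_fun_mult; (intro analytic_intros)?; auto)+
  \<comment> \<open>The inverse of \<open>W\<close>: on the spectrum the power and Gamma do not
    vanish, and the reciprocal Gamma factor vanishes only where l + \<mu> is a nonpositive integer,
    which \<open>D'_spec\<close> excludes.\<close>
  define V where "V = mat_fun (\<lambda>w. inverse (W_fun w)) D"
  have WV: "W ** V = mat 1"
  proof -
    have nz: "W_fun l \<noteq> 0" if "eigenvalue_of D l" for l
      using z D_spec[OF that] D'_spec[OF that] by (auto simp: W_fun_def Gamma_eq_zero_iff rGamma_eq_zero_iff)
    have "W ** V = mat_fun (\<lambda>w. W_fun w * inverse (W_fun w)) D"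
      unfolding W V_def using nz W_analytic by (intro mat_fun_mult[symmetric] analytic_intros) auto
    also have "\<dots> = mat_fun (\<lambda>w. 1) D"
    proof (rule mat_fun_cong)
      fix l assume l: "eigenvalue_of D l"
      then have "isCont W_fun l"
        using W_analytic by (meson analytic_at_imp_isCont analytic_on_analytic_at mem_Collect_eq)
      then have "eventually (\<lambda>w. W_fun w \<noteq> 0) (nhds l)"
        using nz[OF l] by (simp add: isCont_def tendsto_at_iff_tendsto_nhds tendsto_imp_eventually_ne)
      then show "eventually (\<lambda>w. W_fun w * inverse (W_fun w) = 1) (nhds l)"
        by eventually_elim simp
    qed
    finally show ?thesis by (simp add: mat_fun_const)
  qed
  have step: "pRq_term Cs Ds' A B (of_real z) n ** W = X n ** moment n" for n
  proof -
    define P where "P Ms = mat_prod_list (map (\<lambda>M. matrix_inv (mat_pochhammer M n)) Ms)" for Ms :: "(complex^'r^'r) list"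
    define p p' where "p = mat_pochhammer D n" and "p' = mat_pochhammer (D + mat \<mu>) n"
    have split: "Ds = take j Ds @ D # drop (Suc j) Ds"
      using j by (simp add: D_def id_take_nth_drop[symmetric])
    have split': "Ds' = take j Ds @ (D + mat \<mu>) # drop (Suc j) Ds"
      using j by (simp add: Ds'_def upd_conv_take_nth_drop)
    have comm_D: "M ** D = D ** M" if "M \<in> set (drop (Suc j) Ds)" for M
      using that D_in by (intro comm) (auto dest: in_set_dropD)
    \<comment> \<open>Each side is the product with its j-th factor removed, and the two lists
      differ only there.\<close>
    have PP: "P Ds' ** p' = P Ds ** p"
    proof -
      have "P Ds ** p = P (take j Ds) ** P (drop (Suc j) Ds)"
        using cancel_pochhammer_factor[of "take j Ds" D "drop (Suc j) Ds" n] adm comm_D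
        unfolding P_def p_def split[symmetric] by blast
      moreover have "M ** (D + mat \<mu>) = (D + mat \<mu>) ** M" if "M \<in> set (drop (Suc j) Ds)" for M
        using comm_D[OF that] by (simp add: matrix_add_ldistrib matrix_add_rdistrib mat_mult_commute)
      then have "P Ds' ** p' = P (take j Ds) ** P (drop (Suc j) Ds)"
        using cancel_pochhammer_factor[of "take j Ds" "D + mat \<mu>" "drop (Suc j) Ds" n] adm_shift
        unfolding P_def p'_def split'[symmetric] D_def[symmetric] Ds'_def[symmetric] by blast
      ultimately show ?thesis by simp
    qed
    have p: "p = mat_fun (\<lambda>w. pochhammer w n) D"
      using mat_pochhammer_eq_mat_fun[of D 0 n] by (simp add: p_def)
    have p': "p' = mat_fun (\<lambda>w. pochhammer (w + \<mu>) n) D"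
      by (simp add: p'_def mat_pochhammer_eq_mat_fun)
    have p_inv: "invertible p"
      using adm D_in by (auto simp: p_def pRq_admissible_def intro: invertible_mat_pochhammer)
    have "p' ** p = p ** p'"
      unfolding p p' by (intro mat_fun_commute analytic_intros)
    then have comm_inv: "p' ** matrix_inv p = matrix_inv p ** p'"
      by (rule matrix_inv_commute[OF p_inv])
    \<comment> \<open>The scalar identity behind it combines (w)_n Gamma(w) = Gamma(w + n) with
      1/Gamma(w + \<mu>) = (w + \<mu>)_n / Gamma(w + n + \<mu>).\<close>
    have key: "p ** (mat (of_real z ^ n) ** W) = p' ** moment n"
    proof -
      have "p ** (mat (of_real z ^ n) ** W) = mat_fun (\<lambda>w. pochhammer w n * (of_real z ^ n * W_fun w)) D"
        unfolding p W mat_fun_const[symmetric, of "of_real z ^ n" D]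
        by (subst mat_fun_mult, (intro analytic_intros W_analytic)+)+ simp
      also have "\<dots> = mat_fun (\<lambda>w. pochhammer (w + \<mu>) n * moment_fun n w) D"
      proof (rule mat_fun_cong)
        fix l assume l: "eigenvalue_of D l"
        have "open (- \<int>\<^sub>\<le>\<^sub>0 :: complex set)" by (simp add: open_Compl)
        then have "eventually (\<lambda>w. w \<in> - \<int>\<^sub>\<le>\<^sub>0) (nhds l)"
          using D_spec[OF l] by (intro eventually_nhds_in_open) auto
        then show "eventually (\<lambda>w. pochhammer w n * (of_real z ^ n * W_fun w) = pochhammer (w + \<mu>) n * moment_fun n w) (nhds l)"
        proof eventually_elim
          case (elim w)
          then have "pochhammer w n * Gamma w = Gamma (w + of_nat n)"
            by (simp add: pochhammer_Gamma Gamma_eq_zero_iff)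
          moreover have "rGamma (w + \<mu>) = pochhammer (w + \<mu>) n * rGamma (w + of_nat n + \<mu>)"
            using pochhammer_rGamma[of "w + \<mu>" n] by (simp add: add_ac)
          moreover have "of_real z ^ n * of_real z powr (w + (\<mu> - 1)) = of_real z powr (w + of_nat n + \<mu> - 1)"
            using z powr_add[of "complex_of_real z" "of_nat n" "w + (\<mu> - 1)"] by (simp add: powr_nat' algebra_simps)
          ultimately show ?case
            by (simp add: W_fun_def moment_fun_def mult_ac)
        qed
      qed
      also have "\<dots> = p' ** moment n"
        unfolding p' moment_def by (intro mat_fun_mult analytic_intros moment_fun_analytic)
      finally show ?thesis .
    qed
    \<comment> \<open>Inserting the inverse of \<open>p\<close> times \<open>p\<close> makes
      \<open>key\<close> applicable; then \<open>p'\<close> slides past the inverse of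
      \<open>p\<close> and \<open>PP\<close> trades the shifted list for the original one.\<close>
    have "P Ds' ** (mat (of_real z ^ n) ** W) = P Ds' ** (matrix_inv p ** (p ** (mat (of_real z ^ n) ** W)))"
      by (simp add: matrix_mul_assoc) (metis matrix_inv_left[OF p_inv] matrix_mul_assoc matrix_mul_rid)
    also have "\<dots> = P Ds' ** p' ** matrix_inv p ** moment n"
      unfolding key by (simp only: matrix_mul_assoc) (simp only: comm_inv flip: matrix_mul_assoc)
    also have "\<dots> = P Ds ** moment n"
      unfolding PP by (simp add: matrix_inv_right[OF p_inv] flip: matrix_mul_assoc)
    finally have main: "P Ds' ** (mat (of_real z ^ n) ** W) = P Ds ** moment n" .
    have "mat (of_real z ^ n / fact n) ** W = mat (1 / fact n) ** (mat (of_real z ^ n) ** W)"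
      by (simp add: matrix_mul_assoc mat_mult_mat)
    then show ?thesis
      using main by (simp add: pRq_term_def X_def pRq_coeff_def flip: P_def)
         (metis mat_mult_commute matrix_mul_assoc)
  qed
  \<comment> \<open>Cancelling \<open>W\<close> on the right transfers convergence from the moment
    series to the shifted series.\<close>
  have term_eq: "pRq_term Cs Ds' A B (of_real z) n = X n ** moment n ** V" for n
    by (simp add: WV flip: step matrix_mul_assoc)
  have bl: "bounded_linear (\<lambda>M. M ** N)" for N :: "complex^'r^'r"
  proof -
    have "linear (\<lambda>M. M ** N)"
      by (rule linearI) (simp_all add: matrix_add_rdistrib flip: scalar_matrix_assoc)
    then show ?thesis by (simp add: linear_conv_bounded_linear)
  qed
  have summable': "summable (pRq_term Cs Ds' A B (of_real z))"
    unfolding term_eq[abs_def] by (rule bounded_linear.summable[OF bl summable_series])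
  have "pRq Cs Ds' A B (of_real z) ** W = (\<Sum>n. X n ** moment n)"
    unfolding pRq_def by (subst bounded_linear.suminf[OF bl summable']) (simp add: step)
  then show ?thesis
    using RL_integrable_if_spectrum_pos RL_integral_eq summable'
    by (simp add: Let_def ser_eq W_def matrix_mul_assoc flip: D_def Ds'_def)
qed

end
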